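(* Let the orthonormal polynomials $\phi_0=1,\phi_1,\phi_2,\ldots$ be ordered by their total degree and dense in $L^2_w(\Omega)$. Let $g$ be a real polynomial, let $M_n[g]$ be the $(n+1)\times(n+1)$ matrix with elements $[M_n[g]]_{i,j}=\langle\phi_i,g\,\phi_j\rangle$, $0\le i,j\le n$, and let $M_\infty[g]$ be the infinite matrix representation of $M[g]$. Let $f:\mathbb{R}\to\mathbb{R}$ be polynomially bounded, that is, $|f(x)|\le a+b|x|^m$ for all $x\in\mathbb{R}$, for some positive $a,b$ and $m\in\mathbb{N}$. If $f$ is Riemann--Stieltjes integrable with respect to $M[g]$, then $$\lim_{n\to\infty}[f(M_n[g])]_{0,0}=\int_\Omega f(g(x))\,w(x)\,dx.$$
   Context: $\Omega\subset\mathbb{R}^d$, $w:\Omega\to[0,\infty)$ with $\int_\Omega w(x)\,dx=1$. $L^2_w(\Omega)$ is the Hilbert space with inner product $\langle\phi,\psi\rangle=\int_\Omega\overline{\phi(x)}\,\psi(x)\,w(x)\,dx$. The total degree of a monomial $\prod_ix_i^{n_i}$ is $\sum_in_i$, and the total degree of a polynomial is that of its highest monomial. The orthonormal polynomials are ordered by non-decreasing total degree (e.g. graded lexicographic order), so that for every $k$ a sufficiently long initial segment $\phi_0,\dots,\phi_n$ spans all polynomials of total degree at most $k$. Dense means that the linear span is dense (orthonormal basis). For measurable real $g$, $M[g]$ is the maximal (self-adjoint) multiplication operator $\phi\mapsto g\phi$ with domain $\{\phi:\|g\phi\|<\infty\}$. Matrix indices start from $0$. $M_\infty[g]$ is the infinite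 matrix $[\langle\phi_i,g\phi_j\rangle]_{i,j\ge0}$. By standing convention, it is regarded as an operator on $\ell^2$ with domain $\{v\in\ell^2:\|M_\infty[g]v\|<\infty\}$, this operator is self-adjoint, and it is identified with $M[g]$ under the isomorphism $v\mapsto\sum_iv_i\phi_i$ (the domains correspond). Let $E(t)$ be the (right-continuous) spectral family of a self-adjoint operator $A$. A function $f$ is Riemann--Stieltjes integrable on $[a,b]$ with respect to a non-decreasing $\rho$ if the sums $\sum_kf(\xi_k)(\rho(t_k)-\rho(t_{k-1}))$ converge for all partitions $a=t_0<\dots<t_n=b$ with mesh tending to $0$ and any $\xi_k\in[t_{k-1},t_k]$. $f$ is Riemann--Stieltjes integrable with respect to $A$ if, over every finite interval with endpoints that are not eigenvalues of $A$, it is Riemann--Stieltjes integrable with respect to $\|E(t)\phi\|^2$ for all $\phi$ in the Hilbert space. *)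

theory Defs
  imports
    "HOL-Analysis.Analysis"
    "HOL-Library.Poly_Mapping"
    "Jordan_Normal_Form.Schur_Decomposition"
begin

subsection \<open>Polynomials in several variables\<close>

text \<open>A polynomial in the variables indexed by \<open>'d\<close> is the finitely supported map from
  exponents (themselves finitely supported maps) to coefficients.\<close>

type_synonym ('d, 'a) mpolynomial = "('d \<Rightarrow>\<^sub>0 nat) \<Rightarrow>\<^sub>0 'a"

definition eval_mpoly :: "('d::finite, 'a::real_algebra_1) mpolynomial \<Rightarrow> real ^ 'd \<Rightarrow> 'a" where
  "eval_mpoly p x =
     (\<Sum>\<alpha>\<in>Poly_Mapping.keys p.
        Poly_Mapping.lookup p \<alpha> * of_real (\<Prod>i\<in>UNIV. vec_nth x i ^ Poly_Mapping.lookup \<alpha> i))"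

text \<open>The zero polynomial gets total degree 0.\<close>

definition total_degree :: "('d::finite, 'a::zero) mpolynomial \<Rightarrow> nat" where
  "total_degree p =
     Max (insert 0 ((\<lambda>\<alpha>. \<Sum>i\<in>UNIV. Poly_Mapping.lookup \<alpha> i) ` Poly_Mapping.keys p))"

definition spans_by_degree :: "(nat \<Rightarrow> ('d::finite, complex) mpolynomial) \<Rightarrow> bool" where
  "spans_by_degree \<phi> \<longleftrightarrow>
     (\<forall>k. \<exists>n. \<forall>q. total_degree q \<le> k \<longrightarrow>
        (\<exists>c. \<forall>x. eval_mpoly q x = (\<Sum>i\<le>n. c i * eval_mpoly (\<phi> i) x)))"

subsection \<open>Square integrable functions\<close>

text \<open>Elements of the Hilbert space are represented by functions; two functions represent the
  same element iff they agree almost everywhere. The space of square summable sequences is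
  the case of the counting measure on the natural numbers.\<close>

definition L2 :: "'a measure \<Rightarrow> ('a \<Rightarrow> complex) set" where
  "L2 M = {\<phi> \<in> borel_measurable M. integrable M (\<lambda>x. (cmod (\<phi> x))\<^sup>2)}"

definition l2_inner :: "'a measure \<Rightarrow> ('a \<Rightarrow> complex) \<Rightarrow> ('a \<Rightarrow> complex) \<Rightarrow> complex" where
  "l2_inner M \<phi> \<psi> = (LINT x|M. cnj (\<phi> x) * \<psi> x)"

definition l2_norm :: "'a measure \<Rightarrow> ('a \<Rightarrow> complex) \<Rightarrow> real" where
  "l2_norm M \<phi> = sqrt (LINT x|M. (cmod (\<phi> x))\<^sup>2)"

definition l2_dense :: "'a measure \<Rightarrow> ('a \<Rightarrow> complex) set \<Rightarrow> bool" where
  "l2_dense M S \<longleftrightarrow> (\<forall>\<psi>\<in>L2 M. \<forall>\<epsilon>>0. \<exists>\<phi>\<in>S. l2_norm M (\<lambda>x. \<psi> x - \<phi> x) < \<epsilon>)"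

definition l2_orthonormal :: "'a measure \<Rightarrow> (nat \<Rightarrow> 'a \<Rightarrow> complex) \<Rightarrow> bool" where
  "l2_orthonormal M \<phi> \<longleftrightarrow>
     (\<forall>i. \<phi> i \<in> L2 M) \<and> (\<forall>i j. l2_inner M (\<phi> i) (\<phi> j) = (if i = j then 1 else 0))"

definition fun_span :: "(nat \<Rightarrow> 'a \<Rightarrow> complex) \<Rightarrow> ('a \<Rightarrow> complex) set" where
  "fun_span \<phi> = {\<lambda>x. \<Sum>i\<le>n. c i * \<phi> i x | n c. True}"

definition l2_expansion ::
    "'a measure \<Rightarrow> (nat \<Rightarrow> 'a \<Rightarrow> complex) \<Rightarrow> (nat \<Rightarrow> complex) \<Rightarrow> ('a \<Rightarrow> complex) \<Rightarrow> bool" where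
  "l2_expansion M \<phi> v \<psi> \<longleftrightarrow>
     (\<lambda>n. l2_norm M (\<lambda>x. \<psi> x - (\<Sum>i<n. v i * \<phi> i x))) \<longlonglongrightarrow> 0"

definition weighted_measure :: "'a::euclidean_space set \<Rightarrow> ('a \<Rightarrow> real) \<Rightarrow> 'a measure" where
  "weighted_measure \<Omega> w = density (lebesgue_on \<Omega>) (\<lambda>x. ennreal (w x))"

subsection \<open>Unbounded operators\<close>

text \<open>An operator is given by its graph, as a set of pairs of representatives that is
  saturated with respect to equality almost everywhere.\<close>

type_synonym 'a l2_operator = "(('a \<Rightarrow> complex) \<times> ('a \<Rightarrow> complex)) set"

definition op_adjoint :: "'a measure \<Rightarrow> 'a l2_operator \<Rightarrow> 'a l2_operator" where
  "op_adjoint M A =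
     {(\<psi>, \<eta>). \<psi> \<in> L2 M \<and> \<eta> \<in> L2 M \<and> (\<forall>(\<phi>, \<theta>)\<in>A. l2_inner M \<psi> \<theta> = l2_inner M \<eta> \<phi>)}"

definition self_adjoint :: "'a measure \<Rightarrow> 'a l2_operator \<Rightarrow> bool" where
  "self_adjoint M A \<longleftrightarrow> l2_dense M (Domain A) \<and> op_adjoint M A = A"

definition op_eigenvalue :: "'a measure \<Rightarrow> 'a l2_operator \<Rightarrow> real \<Rightarrow> bool" where
  "op_eigenvalue M A c \<longleftrightarrow>
     (\<exists>\<phi>\<in>L2 M. \<not> (AE x in M. \<phi> x = 0) \<and> (\<phi>, \<lambda>x. complex_of_real c * \<phi> x) \<in> A)"

definition mult_op :: "'a measure \<Rightarrow> ('a \<Rightarrow> real) \<Rightarrow> 'a l2_operator" where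
  "mult_op M g =
     {(\<phi>, \<eta>). \<phi> \<in> L2 M \<and> \<eta> \<in> L2 M \<and> (AE x in M. \<eta> x = complex_of_real (g x) * \<phi> x)}"

definition mult_entry ::
    "'a measure \<Rightarrow> (nat \<Rightarrow> 'a \<Rightarrow> complex) \<Rightarrow> ('a \<Rightarrow> real) \<Rightarrow> nat \<Rightarrow> nat \<Rightarrow> complex" where
  "mult_entry M \<phi> g i j = l2_inner M (\<phi> i) (\<lambda>x. complex_of_real (g x) * \<phi> j x)"

text \<open>The maximal operator of an infinite matrix. For a polynomial \<open>g\<close> and orthonormal
  polynomials that exhaust all degrees, every row of \<open>mult_entry M \<phi> g\<close> has only finitely many
  nonzero entries, so the series below are finite sums for all sequences \<open>v\<close>.\<close>

abbreviation ell2_measure :: "nat measure" where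
  "ell2_measure \<equiv> count_space UNIV"

definition matrix_op :: "(nat \<Rightarrow> nat \<Rightarrow> complex) \<Rightarrow> nat l2_operator" where
  "matrix_op a =
     {(v, u). v \<in> L2 ell2_measure \<and> u \<in> L2 ell2_measure \<and> (\<forall>i. u i = suminf (\<lambda>j. a i j * v j))}"

text \<open>The operator \<open>T\<close> on square summable sequences becomes \<open>A\<close> under the isomorphism that maps
  the sequence \<open>v\<close> to the sum of the series with terms \<open>v i * \<phi> i\<close>.\<close>

definition identified_by ::
    "'a measure \<Rightarrow> (nat \<Rightarrow> 'a \<Rightarrow> complex) \<Rightarrow> nat l2_operator \<Rightarrow> 'a l2_operator \<Rightarrow> bool" where
  "identified_by M \<phi> T A \<longleftrightarrow>
     (\<forall>v\<in>L2 ell2_measure. \<forall>u\<in>L2 ell2_measure. \<forall>\<psi>\<in>L2 M. \<forall>\<eta>\<in>L2 M.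
        l2_expansion M \<phi> v \<psi> \<longrightarrow> l2_expansion M \<phi> u \<eta> \<longrightarrow> ((v, u) \<in> T \<longleftrightarrow> (\<psi>, \<eta>) \<in> A))"

subsection \<open>Spectral families\<close>

text \<open>Linearity and boundedness follow from symmetry on the whole space.\<close>

definition orth_projection ::
    "'a measure \<Rightarrow> (('a \<Rightarrow> complex) \<Rightarrow> 'a \<Rightarrow> complex) \<Rightarrow> bool" where
  "orth_projection M P \<longleftrightarrow>
     (\<forall>\<phi>\<in>L2 M. P \<phi> \<in> L2 M \<and> (AE x in M. P (P \<phi>) x = P \<phi> x)) \<and>
     (\<forall>\<phi>\<in>L2 M. \<forall>\<psi>\<in>L2 M. l2_inner M (P \<phi>) \<psi> = l2_inner M \<phi> (P \<psi>))"

definition spectral_resolution ::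
    "'a measure \<Rightarrow> (real \<Rightarrow> ('a \<Rightarrow> complex) \<Rightarrow> 'a \<Rightarrow> complex) \<Rightarrow> bool" where
  "spectral_resolution M E \<longleftrightarrow>
     (\<forall>t. orth_projection M (E t)) \<and>
     (\<forall>s t. \<forall>\<phi>\<in>L2 M. s \<le> t \<longrightarrow> (AE x in M. E s (E t \<phi>) x = E s \<phi> x)) \<and>
     (\<forall>t. \<forall>\<phi>\<in>L2 M. ((\<lambda>s. l2_norm M (\<lambda>x. E s \<phi> x - E t \<phi> x)) \<longlongrightarrow> 0) (at_right t)) \<and>
     (\<forall>\<phi>\<in>L2 M. ((\<lambda>t. l2_norm M (E t \<phi>)) \<longlongrightarrow> 0) at_bot) \<and>
     (\<forall>\<phi>\<in>L2 M. ((\<lambda>t. l2_norm M (\<lambda>x. \<phi> x - E t \<phi> x)) \<longlongrightarrow> 0) at_top)"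

definition spectral_distr ::
    "'a measure \<Rightarrow> (real \<Rightarrow> ('a \<Rightarrow> complex) \<Rightarrow> 'a \<Rightarrow> complex) \<Rightarrow> ('a \<Rightarrow> complex) \<Rightarrow> real \<Rightarrow> real" where
  "spectral_distr M E \<phi> t = (l2_norm M (E t \<phi>))\<^sup>2"

text \<open>This says that the operator is the integral of \<open>t\<close> with respect to \<open>E\<close>: its domain consists
  of the \<open>\<phi>\<close> for which \<open>t\<^sup>2\<close> is integrable against the Stieltjes measure of the square of the norm of
  \<open>E t \<phi>\<close>, and its quadratic form, which determines it by polarization, is the integral of \<open>t\<close>.\<close>

definition spectral_family ::
    "'a measure \<Rightarrow> 'a l2_operator \<Rightarrow> (real \<Rightarrow> ('a \<Rightarrow> complex) \<Rightarrow> 'a \<Rightarrow> complex) \<Rightarrow> bool" where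
  "spectral_family M A E \<longleftrightarrow>
     spectral_resolution M E \<and>
     Domain A = {\<phi> \<in> L2 M. integrable (interval_measure (spectral_distr M E \<phi>)) (\<lambda>t. t\<^sup>2)} \<and>
     (\<forall>(\<phi>, \<eta>)\<in>A. l2_inner M \<phi> \<eta> =
        complex_of_real (LINT t|interval_measure (spectral_distr M E \<phi>). t))"

subsection \<open>Riemann--Stieltjes integrability\<close>

definition rs_integrable :: "(real \<Rightarrow> real) \<Rightarrow> (real \<Rightarrow> real) \<Rightarrow> real \<Rightarrow> real \<Rightarrow> bool" where
  "rs_integrable f \<rho> a b \<longleftrightarrow>
     (\<exists>I. \<forall>\<epsilon>>0. \<exists>\<delta>>0. \<forall>n t \<xi>.
        t 0 = a \<and> t n = b \<and>
        (\<forall>k<n. t k < t (Suc k) \<and> t (Suc k) - t k < \<delta> \<and> \<xi> k \<in> {t k..t (Suc k)}) \<longrightarrow>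
        \<bar>(\<Sum>k<n. f (\<xi> k) * (\<rho> (t (Suc k)) - \<rho> (t k))) - I\<bar> < \<epsilon>)"

text \<open>By the spectral theorem a self-adjoint operator has exactly one spectral family (up to
  equality almost everywhere), so it does not matter how \<open>E\<close> is quantified.\<close>

definition rs_integrable_op :: "'a measure \<Rightarrow> 'a l2_operator \<Rightarrow> (real \<Rightarrow> real) \<Rightarrow> bool" where
  "rs_integrable_op M A f \<longleftrightarrow>
     (\<forall>E. spectral_family M A E \<longrightarrow>
        (\<forall>a b. a < b \<longrightarrow> \<not> op_eigenvalue M A a \<longrightarrow> \<not> op_eigenvalue M A b \<longrightarrow>
           (\<forall>\<phi>\<in>L2 M. rs_integrable f (spectral_distr M E \<phi>) a b)))"

subsection \<open>Functions of Hermitian matrices\<close>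

definition trunc_matrix :: "(nat \<Rightarrow> nat \<Rightarrow> complex) \<Rightarrow> nat \<Rightarrow> complex mat" where
  "trunc_matrix a n = Matrix.mat (n + 1) (n + 1) (\<lambda>(i, j). a i j)"

text \<open>The result does not depend on the choice of the unitary diagonalization.\<close>

definition hermitian_fun :: "(real \<Rightarrow> real) \<Rightarrow> complex mat \<Rightarrow> complex mat" where
  "hermitian_fun f A =
     (THE B. \<exists>U d. U \<in> carrier_mat (dim_row A) (dim_row A) \<and>
        mat_adjoint U * U = 1\<^sub>m (dim_row A) \<and>
        A = U * mat_diag (dim_row A) (\<lambda>i. complex_of_real (d i)) * mat_adjoint U \<and>
        B = U * mat_diag (dim_row A) (\<lambda>i. complex_of_real (f (d i))) * mat_adjoint U)"

end

theory Submission
  imports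
    Defs
    "Jordan_Normal_Form.Spectral_Radius"
    "HOL-Probability.Probability"
    "HOL-Complex_Analysis.Great_Picard"
begin

text \<open>The number \<open>[f(M\<^sub>n)]\<^sub>0\<^sub>0\<close> is a quadrature sum: if \<open>u\<close> is a unitary matrix that diagonalizes \<open>M\<^sub>n\<close>, with
eigenvalues \<open>d\<close>, it equals \<open>\<Sum>k\<le>n. \<bar>u 0 k\<bar>\<^sup>2 f(d k)\<close>. The weights are nonnegative with sum 1, so the claim is
that these discrete probability measures converge to the distribution \<open>\<mu>\<close> of \<open>g\<close> under \<open>w(x) dx\<close>, when
tested against \<open>f\<close>. A quadrature sum is a positive functional, and so it suffices to enclose \<open>f\<close> between
functions \<open>l \<le> f \<le> u\<close> for which convergence is known and whose integrals against \<open>\<mu>\<close> differ by little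
(\<open>quad_sandwich\<close>).

Convergence is known for two kinds of functions. For powers, the sums are eventually constant and exact,
because a power of \<open>g\<close> is a polynomial, hence a combination of finitely many of the \<open>\<phi>\<^sub>i\<close>
(\<open>truncated_moments_exact\<close>). Moments alone need not determine \<open>\<mu>\<close>; the self-adjointness of \<open>M\<^sub>\<infinity>\<close>
supplies the rest, through the resolvents \<open>x \<mapsto> 1/(x - z)\<close> with nonreal \<open>z\<close>
(\<open>truncated_resolvent_tendsto\<close>): the vectors \<open>(M\<^sub>n - z)\<^sup>-\<^sup>1 e\<^sub>0\<close> are bounded in \<open>\<ell>\<^sup>2\<close>, each row of \<open>M\<^sub>\<infinity>\<close>
has only finitely many nonzero entries, and therefore every coordinatewise limit \<open>v\<close> along a subsequence
satisfies \<open>M\<^sub>\<infinity> v = z v + e\<^sub>0\<close>. The coefficients of the function \<open>1/(g - z)\<close> satisfy the same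
equation, and since a self-adjoint operator has no nonreal eigenvalue, the two solutions agree.

The imaginary part of a resolvent is a Poisson kernel. Integrating Poisson kernels over an interval gives
differences of arctangents, which squeeze the indicator of the interval when its endpoints are not atoms of
\<open>\<mu>\<close> (\<open>converges_indicator\<close>). So step functions with such jumps are admissible as \<open>l\<close> and \<open>u\<close>.

The Riemann--Stieltjes hypothesis enters through the concrete spectral family of \<open>M[g]\<close>, multiplication by the
indicator of \<open>g \<le> t\<close> (\<open>spectral_family_mult_op\<close>), for which \<open>\<parallel>E(t)1\<parallel>\<^sup>2\<close> is the distribution function of
\<open>\<mu>\<close>. It makes upper and lower step functions of \<open>f\<close> on \<open>(-R, R]\<close> as close as desired, and a multiple of
\<open>x ^ (2m + 2)\<close> that tends to 0 as \<open>R\<close> grows dominates \<open>f\<close> outside of this interval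
(\<open>polynomially_bounded_sandwich\<close>). The same enclosure shows that \<open>f \<circ> g\<close> times \<open>w\<close> is measurable, since Lebesgue
measure is complete.\<close>

section \<open>Unitary diagonalization of Hermitian matrices\<close>

lemma mat_adjoint_dim [simp]:
  "dim_row (mat_adjoint A) = dim_col A" "dim_col (mat_adjoint A) = dim_row A"
  by (auto simp: mat_adjoint_def)

lemma mat_adjoint_carrier: "A \<in> carrier_mat n m \<Longrightarrow> mat_adjoint A \<in> carrier_mat m n"
  by auto

lemma mat_adjoint_index [simp]:
  "i < dim_col A \<Longrightarrow> j < dim_row A \<Longrightarrow> mat_adjoint A $$ (i, j) = conjugate (A $$ (j, i))"
  by (simp add: mat_adjoint_def mat_of_rows_def)

lemma mat_adjoint_mult:
  fixes A B :: "complex mat"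
  assumes "A \<in> carrier_mat n m" "B \<in> carrier_mat m k"
  shows "mat_adjoint (A * B) = mat_adjoint B * mat_adjoint A"
  using assms by (intro eq_matI) (auto simp: scalar_prod_def mult.commute intro!: sum.cong)

lemma mat_adjoint_adjoint [simp]: "mat_adjoint (mat_adjoint (A :: complex mat)) = A"
  by (intro eq_matI) auto

lemma mat_adjoint_four_block:
  fixes A B C D :: "complex mat"
  assumes "A \<in> carrier_mat a b" "B \<in> carrier_mat a d" "C \<in> carrier_mat c b" "D \<in> carrier_mat c d"
  shows "mat_adjoint (four_block_mat A B C D) =
    four_block_mat (mat_adjoint A) (mat_adjoint C) (mat_adjoint B) (mat_adjoint D)"
  using assms by (intro eq_matI) auto

text \<open>Connects the inverse used in the Schur decomposition, which divides each column by its squared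
norm, with the adjoint.\<close>

lemma corthogonal_inv_unit_columns:
  fixes W :: "complex mat"
  assumes "\<And>j. j < dim_col W \<Longrightarrow> col W j \<bullet>c col W j = 1"
  shows "corthogonal_inv W = mat_adjoint W"
proof -
  have "map vec_inv (cols W) = map conjugate (cols W)"
    using assms by (auto simp: vec_inv_def in_set_conv_nth)
  then show ?thesis
    unfolding corthogonal_inv_def mat_adjoint_def by (rule arg_cong)
qed

text \<open>One deflation step: complete an eigenvector to a basis, orthogonalize it by Gram--Schmidt and
normalize. The first column of the conjugated matrix is then the eigenvalue times the first unit vector.\<close>

lemma unitary_first_column_eigenvector:
  fixes A :: "complex mat"
  assumes A: "A \<in> carrier_mat n n" and n: "n > 0"
  obtains W e where "W \<in> carrier_mat n n" "mat_adjoint W * W = 1\<^sub>m n"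
    "col (mat_adjoint W * A * W) 0 = vec n (\<lambda>i. if i = 0 then e else 0)"
proof -
  interpret cof_vec_space n "TYPE(complex)" .
  obtain e where "e \<in> spectrum A"
    using spectrum_non_empty[OF A n] by auto
  then obtain v where ev: "eigenvector A v e"
    by (auto simp: spectrum_def eigenvalue_def)
  with A have v: "v \<in> carrier_vec n" "v \<noteq> 0\<^sub>v n" and Av: "A *\<^sub>v v = e \<cdot>\<^sub>v v"
    by (auto simp: eigenvector_def)
  define b where "b = basis_completion v"
  note bc = basis_completion[OF v, folded b_def]
  obtain vs where bv: "b = v # vs"
    using bc n by (cases b) auto
  define ws where "ws = gram_schmidt n b"
  note gs = gram_schmidt_result[OF bc(2,4,5) ws_def]
  have len: "length ws = n" using gs bc by simp
  have hd_ws: "hd ws = v"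
    using gram_schmidt_hd[OF v(1), of vs, folded bv] by (simp add: ws_def)
  define normed where "normed = (\<lambda>w. complex_of_real (1 / sqrt (Re (w \<bullet>c w))) \<cdot>\<^sub>v w)"
  have normed_prod: "normed u \<bullet>c normed w =
      complex_of_real (1 / sqrt (Re (u \<bullet>c u)) * (1 / sqrt (Re (w \<bullet>c w)))) * (u \<bullet>c w)"
    if "u \<in> carrier_vec n" "w \<in> carrier_vec n" for u w
    using that by (simp add: normed_def conjugate_smult_vec)
  have sq_pos: "w \<bullet>c w = complex_of_real (Re (w \<bullet>c w))" "Re (w \<bullet>c w) > 0"
    if "w \<in> carrier_vec n" "w \<bullet>c w \<noteq> 0" for w
  proof -
    have "w \<bullet>c w \<ge> 0" by (rule conjugate_square_ge_0_vec)
    then show "w \<bullet>c w = complex_of_real (Re (w \<bullet>c w))" "Re (w \<bullet>c w) > 0"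
      using that(2) by (auto simp: less_eq_complex_def complex_eq_iff)
  qed
  have nz: "ws ! i \<bullet>c ws ! j = 0 \<longleftrightarrow> i \<noteq> j" if "i < n" "j < n" for i j
    using corthogonalD[OF gs(2)] that len by simp
  have cws: "ws ! i \<in> carrier_vec n" if "i < n" for i
    using gs(3) that len by auto
  define us where "us = map normed ws"
  have lenu: "length us = n" by (simp add: us_def len)
  have cus: "us ! i \<in> carrier_vec n" if "i < n" for i
    using cws[OF that] that len by (simp add: us_def normed_def)
  have set_us: "set us \<subseteq> carrier_vec n"
    using cus lenu by (auto simp: in_set_conv_nth)
  have us_prod: "us ! i \<bullet>c us ! j = (if i = j then 1 else 0)" if "i < n" "j < n" for i j
  proof (cases "i = j")
    case True
    let ?r = "Re (ws ! i \<bullet>c ws ! i)"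
    have r: "ws ! i \<bullet>c ws ! i = complex_of_real ?r" "?r > 0"
      using sq_pos[OF cws[OF that(1)]] nz[OF that(1) that(1)] by blast+
    have "us ! i \<bullet>c us ! i = complex_of_real (1 / sqrt ?r * (1 / sqrt ?r)) * complex_of_real ?r"
      using normed_prod[OF cws[OF that(1)] cws[OF that(1)]] that len r(1) by (simp add: us_def)
    also have "\<dots> = complex_of_real (1 / sqrt ?r * (1 / sqrt ?r) * ?r)" by simp
    also have "1 / sqrt ?r * (1 / sqrt ?r) * ?r = 1"
      using r(2) by simp
    finally show ?thesis using True by simp
  next
    case False
    then show ?thesis
      using normed_prod[OF cws[OF that(1)] cws[OF that(2)]] that len nz[OF that] by (simp add: us_def)
  qed
  have cor: "corthogonal us"
    using us_prod lenu by (intro corthogonalI) auto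
  define W where "W = mat_of_cols n us"
  have W: "W \<in> carrier_mat n n"
    using lenu by (auto simp: W_def)
  have colW: "col W j = us ! j" if "j < n" for j
    using cus[OF that] that lenu by (simp add: W_def)
  have inv: "corthogonal_inv W = mat_adjoint W"
    using W us_prod by (intro corthogonal_inv_unit_columns) (auto simp: colW)
  have "inverts_mat (corthogonal_inv W) W"
    using orthogonal_mat_of_cols[OF set_us cor lenu] unfolding W_def
    by (rule corthogonal_inv_result)
  then have unit: "mat_adjoint W * W = 1\<^sub>m n"
    using W by (simp add: inv inverts_mat_def)
  have ws0: "ws ! 0 = v" using hd_ws len n by (metis hd_conv_nth length_greater_0_conv)
  have hd_us: "hd us = normed v"
    using n len ws0 by (cases ws) (auto simp: us_def)
  have "normed v \<in> carrier_vec n" using v by (simp add: normed_def)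
  moreover have "normed v \<noteq> 0\<^sub>v n"
    using us_prod[of 0 0] hd_us lenu n by (auto simp: hd_conv_nth us_def len ws0)
  moreover have "A *\<^sub>v normed v = e \<cdot>\<^sub>v normed v"
    using A v Av by (simp add: normed_def mult_mat_vec smult_smult_assoc mult.commute)
  ultimately have "col (corthogonal_inv W * A * W) 0 = vec n (\<lambda>i. if i = 0 then e else 0)"
    using corthogonal_col_ev_0[OF A _ _ _ _ hd_us set_us cor lenu] n unfolding W_def by simp
  with that[OF W unit] inv show ?thesis by simp
qed

text \<open>By induction on the size. After the deflation step the first column vanishes below the diagonal, and
by symmetry so does the first row to the right of the diagonal; the remaining block is again Hermitian.\<close>

theorem hermitian_unitary_diagonalization:
  fixes A :: "complex mat"
  assumes "A \<in> carrier_mat n n" "mat_adjoint A = A"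
  shows "\<exists>U d. U \<in> carrier_mat n n \<and> mat_adjoint U * U = 1\<^sub>m n \<and>
    A = U * mat_diag n (\<lambda>i. complex_of_real (d i)) * mat_adjoint U"
  using assms
proof (induction n arbitrary: A)
  case 0
  then show ?case by (intro exI[of _ A] exI[of _ "\<lambda>_. 0"] conjI eq_matI) auto
next
  case (Suc n)
  note A = Suc.prems(1)
  obtain W e where W: "W \<in> carrier_mat (Suc n) (Suc n)" and unit: "mat_adjoint W * W = 1\<^sub>m (Suc n)"
    and c0: "col (mat_adjoint W * A * W) 0 = vec (Suc n) (\<lambda>i. if i = 0 then e else 0)"
    using unitary_first_column_eigenvector[OF A] by auto
  define B where "B = mat_adjoint W * A * W"
  have aW: "mat_adjoint W \<in> carrier_mat (Suc n) (Suc n)" using W by (rule mat_adjoint_carrier)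
  have B: "B \<in> carrier_mat (Suc n) (Suc n)" using W A aW by (simp add: B_def)
  have adjB: "mat_adjoint B = B"
    using W A aW Suc.prems(2)
    by (simp add: B_def mat_adjoint_mult[of _ "Suc n" "Suc n" _ "Suc n"] assoc_mult_mat[of _ "Suc n" "Suc n" _ "Suc n" _ "Suc n"])
  have herm: "B $$ (i, j) = cnj (B $$ (j, i))" if "i < Suc n" "j < Suc n" for i j
    using arg_cong[OF adjB, of "\<lambda>M. M $$ (i, j)"] that B by simp
  have B0: "B $$ (i, 0) = (if i = 0 then e else 0)" if "i < Suc n" for i
    using arg_cong[OF c0[folded B_def], of "\<lambda>v. v $ i"] that B by simp
  have e: "e = complex_of_real (Re e)"
    using herm[of 0 0] B0[of 0] by (simp add: complex_eq_iff)
  define C where "C = mat n n (\<lambda>(i, j). B $$ (Suc i, Suc j))"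
  have C: "C \<in> carrier_mat n n" by (simp add: C_def)
  have "mat_adjoint C = C"
    by (intro eq_matI) (auto simp: C_def herm[symmetric])
  then obtain V d where V: "V \<in> carrier_mat n n" "mat_adjoint V * V = 1\<^sub>m n"
    and CV: "C = V * mat_diag n (\<lambda>i. complex_of_real (d i)) * mat_adjoint V"
    using Suc.IH[OF C] by blast
  define d' where "d' = case_nat (Re e) d"
  define V' where "V' = four_block_mat (1\<^sub>m 1) (0\<^sub>m 1 n) (0\<^sub>m n 1) V"
  have one: "mat_adjoint (1\<^sub>m 1) = (1\<^sub>m 1 :: complex mat)"
    "mat_adjoint (0\<^sub>m n 1) = (0\<^sub>m 1 n :: complex mat)" "mat_adjoint (0\<^sub>m 1 n) = (0\<^sub>m n 1 :: complex mat)"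
    by (auto intro!: eq_matI)
  have aV: "mat_adjoint V \<in> carrier_mat n n" using V(1) by (rule mat_adjoint_carrier)
  have aV': "mat_adjoint V' = four_block_mat (1\<^sub>m 1) (0\<^sub>m 1 n) (0\<^sub>m n 1) (mat_adjoint V)"
    unfolding V'_def using V by (subst mat_adjoint_four_block[of _ 1 1 _ n _ n]) (auto simp: one)
  have V': "V' \<in> carrier_mat (Suc n) (Suc n)" using V by (auto simp: V'_def)
  define Dm where "Dm = mat_diag n (\<lambda>i. complex_of_real (d i))"
  have Dm: "Dm \<in> carrier_mat n n" by (simp add: Dm_def)
  have diag: "mat_diag (Suc n) (\<lambda>i. complex_of_real (d' i)) =
      four_block_mat (mat 1 1 (\<lambda>_. e)) (0\<^sub>m 1 n) (0\<^sub>m n 1) (mat_diag n (\<lambda>i. complex_of_real (d i)))"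
    using e by (intro eq_matI) (auto simp: mat_diag_def d'_def split: nat.split)
  have unitV': "mat_adjoint V' * V' = 1\<^sub>m (Suc n)"
    unfolding aV' unfolding V'_def using V aV
    by (subst mult_four_block_mat[of _ 1 1 _ n _ n _ _ 1 _ n]) (auto intro!: eq_matI)
  have "V' * mat_diag (Suc n) (\<lambda>i. complex_of_real (d' i)) * mat_adjoint V' =
      four_block_mat (mat 1 1 (\<lambda>_. e)) (0\<^sub>m 1 n) (0\<^sub>m n 1) C"
    unfolding aV' diag Dm_def[symmetric] unfolding V'_def using V aV Dm CV[folded Dm_def]
    by (subst mult_four_block_mat[of _ 1 1 _ n _ n _ _ 1 _ n], simp_all)+
  also have "\<dots> = B"
  proof (intro eq_matI)
    fix i j assume "i < dim_row B" "j < dim_col B"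
    then have "i < Suc n" "j < Suc n" using B by auto
    moreover have "B $$ (0, j) = 0" if "j \<noteq> 0"
      using herm[of 0 j] B0[of j] that \<open>j < Suc n\<close> by simp
    ultimately show "four_block_mat (mat 1 1 (\<lambda>_. e)) (0\<^sub>m 1 n) (0\<^sub>m n 1) C $$ (i, j) = B $$ (i, j)"
      using B0[of i] C by (auto simp: C_def)
  qed (use B C in auto)
  finally have BV: "B = V' * mat_diag (Suc n) (\<lambda>i. complex_of_real (d' i)) * mat_adjoint V'" ..
  have right: "W * mat_adjoint W = 1\<^sub>m (Suc n)"
    using mat_mult_left_right_inverse[OF aW W unit] .
  note assoc = assoc_mult_mat[of _ "Suc n" "Suc n" _ "Suc n" _ "Suc n"]
  have "W * B * mat_adjoint W = (W * mat_adjoint W) * A * (W * mat_adjoint W)"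
    using W A aW by (simp add: B_def assoc)
  then have AB: "A = W * B * mat_adjoint W" using A by (simp add: right)
  have aVc: "mat_adjoint V' \<in> carrier_mat (Suc n) (Suc n)" using V' by (rule mat_adjoint_carrier)
  have adjWV: "mat_adjoint (W * V') = mat_adjoint V' * mat_adjoint W"
    using W V' by (rule mat_adjoint_mult)
  have "mat_adjoint (W * V') * (W * V') = mat_adjoint V' * (mat_adjoint W * W) * V'"
    using W V' aW aVc unfolding adjWV by (simp add: assoc)
  also have "\<dots> = 1\<^sub>m (Suc n)" using unit unitV' by (simp add: right_mult_one_mat[OF aVc])
  finally have "mat_adjoint (W * V') * (W * V') = 1\<^sub>m (Suc n)" .
  moreover
  define De where "De = mat_diag (Suc n) (\<lambda>i. complex_of_real (d' i))"
  have De: "De \<in> carrier_mat (Suc n) (Suc n)" by (simp add: De_def)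
  have "A = W * V' * mat_diag (Suc n) (\<lambda>i. complex_of_real (d' i)) * mat_adjoint (W * V')"
    unfolding adjWV De_def[symmetric] using W V' aW aVc De
    by (subst AB, subst BV[folded De_def]) (simp add: assoc)
  ultimately show ?case
    using W V' by (intro exI[of _ "W * V'"] exI[of _ d']) simp
qed

lemma unitary_conjugation_index:
  assumes "U \<in> carrier_mat n n" "i < n" "j < n"
  shows "(U * mat_diag n h * mat_adjoint U) $$ (i, j) =
    (\<Sum>k<n. U $$ (i, k) * h k * cnj (U $$ (j, k)))"
  using assms
  by (simp add: mat_diag_mult_right[of _ n n] scalar_prod_def lessThan_atLeast0)

text \<open>The unitary matrix \<open>W\<close> that relates two diagonalizations intertwines the two diagonal matrices, so it
only connects equal eigenvalues, and hence it also intertwines their images under \<open>f\<close>.\<close>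

lemma unitary_diagonalization_fun_unique:
  fixes U V :: "complex mat" and f :: "real \<Rightarrow> real"
  assumes U: "U \<in> carrier_mat n n" "mat_adjoint U * U = 1\<^sub>m n"
    and V: "V \<in> carrier_mat n n" "mat_adjoint V * V = 1\<^sub>m n"
    and eq: "U * mat_diag n (\<lambda>i. complex_of_real (d i)) * mat_adjoint U =
             V * mat_diag n (\<lambda>i. complex_of_real (e i)) * mat_adjoint V"
  shows "U * mat_diag n (\<lambda>i. complex_of_real (f (d i))) * mat_adjoint U =
         V * mat_diag n (\<lambda>i. complex_of_real (f (e i))) * mat_adjoint V"
proof -
  note assoc = assoc_mult_mat[of _ n n _ n _ n]
  have aU: "mat_adjoint U \<in> carrier_mat n n" and aV: "mat_adjoint V \<in> carrier_mat n n"
    using U V by (auto intro: mat_adjoint_carrier)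
  have rU: "U * mat_adjoint U = 1\<^sub>m n" and rV: "V * mat_adjoint V = 1\<^sub>m n"
    using mat_mult_left_right_inverse[OF aU U(1) U(2)] mat_mult_left_right_inverse[OF aV V(1) V(2)] .
  define W where "W = mat_adjoint V * U"
  have W: "W \<in> carrier_mat n n" using U aV by (auto simp: W_def)
  define Dd De where "Dd = mat_diag n (\<lambda>i. complex_of_real (d i))" "De = mat_diag n (\<lambda>i. complex_of_real (e i))"
  have Dc: "Dd \<in> carrier_mat n n" "De \<in> carrier_mat n n" by (auto simp: Dd_De_def)
  have "W * Dd = mat_adjoint V * (U * Dd * mat_adjoint U) * U"
    using U V(1) aU aV Dc by (simp add: W_def assoc)
  also have "\<dots> = (mat_adjoint V * V) * De * W"
    unfolding eq[folded Dd_De_def] using U(1) V(1) aU aV Dc by (simp add: W_def assoc)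
  also have "\<dots> = De * W"
    using V(2) Dc by simp
  finally have WD: "W * mat_diag n (\<lambda>i. complex_of_real (d i)) = mat_diag n (\<lambda>i. complex_of_real (e i)) * W"
    by (simp only: Dd_De_def)
  have WD_entry: "W $$ (i, j) = 0 \<or> d j = e i" if "i < n" "j < n" for i j
    using arg_cong[OF WD, of "\<lambda>M. M $$ (i, j)"] that W
    by (auto simp: mat_diag_mult_left[of _ n n] mat_diag_mult_right[of _ n n])
  define Fd Fe where "Fd = mat_diag n (\<lambda>i. complex_of_real (f (d i)))" "Fe = mat_diag n (\<lambda>i. complex_of_real (f (e i)))"
  have Fc: "Fd \<in> carrier_mat n n" "Fe \<in> carrier_mat n n" by (auto simp: Fd_Fe_def)
  have WF: "W * Fd = Fe * W"
    unfolding Fd_Fe_def using W WD_entry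
    by (subst mat_diag_mult_left[of _ n n], simp, subst mat_diag_mult_right[of _ n n], simp)
      (intro eq_matI; force)
  have "U * Fd * mat_adjoint U = (V * mat_adjoint V) * (U * Fd * mat_adjoint U)"
    using U aU Fc by (simp add: rV)
  also have "\<dots> = V * (W * Fd) * mat_adjoint U"
    using U V aU aV Fc by (simp add: W_def assoc)
  also have "\<dots> = V * Fe * mat_adjoint V * (U * mat_adjoint U)"
    unfolding WF using U V aU aV Fc by (simp add: W_def assoc)
  finally show ?thesis using V aV Fc by (simp add: rU Fd_Fe_def)
qed

text \<open>The definite description in the functional calculus is met by every unitary diagonalization.\<close>

lemma hermitian_fun_eq:
  fixes f :: "real \<Rightarrow> real"
  assumes A: "A \<in> carrier_mat n n"
    and U: "U \<in> carrier_mat n n" "mat_adjoint U * U = 1\<^sub>m n"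
    and AU: "A = U * mat_diag n (\<lambda>i. complex_of_real (d i)) * mat_adjoint U"
  shows "hermitian_fun f A = U * mat_diag n (\<lambda>i. complex_of_real (f (d i))) * mat_adjoint U"
proof -
  have dim: "dim_row A = n" using A by simp
  show ?thesis
    unfolding hermitian_fun_def dim
  proof (rule the_equality, intro exI conjI)
    fix B
    assume "\<exists>V e. V \<in> carrier_mat n n \<and> mat_adjoint V * V = 1\<^sub>m n \<and>
      A = V * mat_diag n (\<lambda>i. complex_of_real (e i)) * mat_adjoint V \<and>
      B = V * mat_diag n (\<lambda>i. complex_of_real (f (e i))) * mat_adjoint V"
    then show "B = U * mat_diag n (\<lambda>i. complex_of_real (f (d i))) * mat_adjoint U"
      using unitary_diagonalization_fun_unique[OF _ _ U] AU by metis
  qed (use U AU in auto)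
qed

section \<open>Square integrable functions\<close>

lemma L2_measurable: "\<phi> \<in> L2 M \<Longrightarrow> \<phi> \<in> borel_measurable M"
  by (simp add: L2_def)

lemma L2_square_integrable: "\<phi> \<in> L2 M \<Longrightarrow> integrable M (\<lambda>x. (cmod (\<phi> x))\<^sup>2)"
  by (simp add: L2_def)

lemma borel_measurable_cnj:
  assumes "\<phi> \<in> borel_measurable M"
  shows "(\<lambda>x. cnj (\<phi> x)) \<in> borel_measurable M"
  by (rule borel_measurable_continuous_on[OF _ assms]) (auto intro: continuous_intros)

lemma L2_cmult:
  assumes "\<phi> \<in> L2 M" shows "(\<lambda>x. c * \<phi> x) \<in> L2 M"
  using assms by (auto simp: L2_def norm_mult power_mult_distrib)

lemma L2_add:
  assumes "\<phi> \<in> L2 M" "\<psi> \<in> L2 M" shows "(\<lambda>x. \<phi> x + \<psi> x) \<in> L2 M"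
proof -
  note [measurable] = assms[THEN L2_measurable]
  have "integrable M (\<lambda>x. (cmod (\<phi> x + \<psi> x))\<^sup>2)"
  proof (rule Bochner_Integration.integrable_bound)
    show "integrable M (\<lambda>x. 2 * ((cmod (\<phi> x))\<^sup>2 + (cmod (\<psi> x))\<^sup>2))"
      using assms by (intro integrable_mult_right Bochner_Integration.integrable_add L2_square_integrable)
    show "AE x in M. norm ((cmod (\<phi> x + \<psi> x))\<^sup>2) \<le> norm (2 * ((cmod (\<phi> x))\<^sup>2 + (cmod (\<psi> x))\<^sup>2))"
    proof (rule AE_I2)
      fix x
      have "(cmod (\<phi> x + \<psi> x))\<^sup>2 \<le> (cmod (\<phi> x) + cmod (\<psi> x))\<^sup>2"
        by (intro power_mono norm_triangle_ineq) auto
      also have "\<dots> \<le> 2 * ((cmod (\<phi> x))\<^sup>2 + (cmod (\<psi> x))\<^sup>2)"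
        using sum_squares_bound[of "cmod (\<phi> x)" "cmod (\<psi> x)"] by (simp add: power2_sum)
      finally show "norm ((cmod (\<phi> x + \<psi> x))\<^sup>2) \<le> norm (2 * ((cmod (\<phi> x))\<^sup>2 + (cmod (\<psi> x))\<^sup>2))"
        by simp
    qed
  qed measurable
  then show ?thesis by (simp add: L2_def)
qed

lemma L2_sum:
  assumes "finite I" "\<And>i. i \<in> I \<Longrightarrow> \<phi> i \<in> L2 M"
  shows "(\<lambda>x. \<Sum>i\<in>I. \<phi> i x) \<in> L2 M"
  using assms
proof (induction I rule: finite_induct)
  case empty
  then show ?case by (simp add: L2_def)
next
  case (insert i I)
  then show ?case by (auto intro!: L2_add)
qed

lemma L2_product_integrable:
  assumes "\<phi> \<in> L2 M" "\<psi> \<in> L2 M"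
  shows "integrable M (\<lambda>x. cnj (\<phi> x) * \<psi> x)"
proof (rule Bochner_Integration.integrable_bound)
  show "integrable M (\<lambda>x. (cmod (\<phi> x))\<^sup>2 + (cmod (\<psi> x))\<^sup>2)"
    using assms by (intro Bochner_Integration.integrable_add L2_square_integrable)
  show "(\<lambda>x. cnj (\<phi> x) * \<psi> x) \<in> borel_measurable M"
    using assms by (intro borel_measurable_times borel_measurable_cnj L2_measurable)
  show "AE x in M. norm (cnj (\<phi> x) * \<psi> x) \<le> norm ((cmod (\<phi> x))\<^sup>2 + (cmod (\<psi> x))\<^sup>2)"
  proof (rule AE_I2)
    fix x
    have "cmod (\<phi> x) * cmod (\<psi> x) \<le> (cmod (\<phi> x))\<^sup>2 + (cmod (\<psi> x))\<^sup>2"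
      using sum_squares_bound[of "cmod (\<phi> x)" "cmod (\<psi> x)"]
        mult_nonneg_nonneg[OF norm_ge_zero norm_ge_zero, of "\<phi> x" "\<psi> x"] by linarith
    then show "norm (cnj (\<phi> x) * \<psi> x) \<le> norm ((cmod (\<phi> x))\<^sup>2 + (cmod (\<psi> x))\<^sup>2)"
      by (simp add: norm_mult)
  qed
qed

lemma l2_inner_commute: "l2_inner M \<psi> \<phi> = cnj (l2_inner M \<phi> \<psi>)"
proof -
  have "cnj (l2_inner M \<phi> \<psi>) = (LINT x|M. cnj (cnj (\<phi> x) * \<psi> x))"
    unfolding l2_inner_def by (rule Bochner_Integration.integral_cnj[symmetric])
  then show ?thesis by (simp add: l2_inner_def mult.commute)
qed

lemma l2_inner_sum_right:
  assumes "finite I" "\<psi> \<in> L2 M" "\<And>i. i \<in> I \<Longrightarrow> \<phi> i \<in> L2 M"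
  shows "l2_inner M \<psi> (\<lambda>x. \<Sum>i\<in>I. c i * \<phi> i x) = (\<Sum>i\<in>I. c i * l2_inner M \<psi> (\<phi> i))"
proof -
  have "l2_inner M \<psi> (\<lambda>x. \<Sum>i\<in>I. c i * \<phi> i x) = (LINT x|M. (\<Sum>i\<in>I. c i * (cnj (\<psi> x) * \<phi> i x)))"
    by (simp add: l2_inner_def sum_distrib_left mult_ac)
  also have "\<dots> = (\<Sum>i\<in>I. (LINT x|M. c i * (cnj (\<psi> x) * \<phi> i x)))"
    using assms by (intro Bochner_Integration.integral_sum integrable_mult_right L2_product_integrable)
  finally show ?thesis by (simp add: l2_inner_def)
qed

lemma l2_inner_diff_right:
  assumes "\<psi> \<in> L2 M" "\<phi> \<in> L2 M" "\<theta> \<in> L2 M"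
  shows "l2_inner M \<psi> (\<lambda>x. \<phi> x - \<theta> x) = l2_inner M \<psi> \<phi> - l2_inner M \<psi> \<theta>"
  unfolding l2_inner_def right_diff_distrib
  using assms by (intro Bochner_Integration.integral_diff L2_product_integrable)

lemma l2_inner_self:
  "l2_inner M \<phi> \<phi> = complex_of_real (LINT x|M. (cmod (\<phi> x))\<^sup>2)"
proof -
  have "l2_inner M \<phi> \<phi> = (LINT x|M. complex_of_real ((cmod (\<phi> x))\<^sup>2))"
    by (simp only: l2_inner_def complex_norm_square mult.commute)
  then show ?thesis by (simp only: integral_complex_of_real)
qed

text \<open>The squared norm of \<open>h\<close> minus its partial expansion is nonnegative.\<close>

lemma bessel_inequality:
  assumes orth: "l2_orthonormal M \<phi>" and h: "h \<in> L2 M"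
  shows "(\<Sum>i<n. (cmod (l2_inner M (\<phi> i) h))\<^sup>2) \<le> (LINT x|M. (cmod (h x))\<^sup>2)"
proof -
  define c where "c i = l2_inner M (\<phi> i) h" for i
  define s where "s = (\<lambda>x. \<Sum>i<n. c i * \<phi> i x)"
  have \<phi>: "\<phi> i \<in> L2 M" for i using orth by (simp add: l2_orthonormal_def)
  have s: "s \<in> L2 M" unfolding s_def by (intro L2_sum L2_cmult \<phi>) auto
  have d: "(\<lambda>x. h x - s x) \<in> L2 M"
    using L2_add[OF h L2_cmult[OF s, of "-1"]] by simp
  have ps: "l2_inner M (\<phi> i) s = c i" if "i < n" for i
  proof -
    have "l2_inner M (\<phi> i) s = (\<Sum>j<n. c j * l2_inner M (\<phi> i) (\<phi> j))"
      unfolding s_def by (rule l2_inner_sum_right) (auto intro: \<phi>)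
    also have "\<dots> = (\<Sum>j<n. if i = j then c j else 0)"
      using orth by (intro sum.cong) (auto simp: l2_orthonormal_def)
    finally show ?thesis using that by simp
  qed
  have ss: "l2_inner M s s = (\<Sum>i<n. c i * cnj (c i))" and hs: "l2_inner M h s = (\<Sum>i<n. c i * cnj (c i))"
  proof -
    have "l2_inner M u s = (\<Sum>i<n. c i * l2_inner M u (\<phi> i))" if "u \<in> L2 M" for u
      unfolding s_def by (rule l2_inner_sum_right) (auto intro: \<phi> that)
    note expand = this
    have "l2_inner M s (\<phi> i) = cnj (c i)" if "i < n" for i
      by (subst l2_inner_commute) (simp add: ps that)
    then show "l2_inner M s s = (\<Sum>i<n. c i * cnj (c i))"
      unfolding expand[OF s] by simp
    have "l2_inner M h (\<phi> i) = cnj (c i)" for i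
      unfolding c_def by (rule l2_inner_commute)
    then show "l2_inner M h s = (\<Sum>i<n. c i * cnj (c i))"
      unfolding expand[OF h] by simp
  qed
  have sq: "(\<Sum>i<n. c i * cnj (c i)) = complex_of_real (\<Sum>i<n. (cmod (c i))\<^sup>2)"
    by (simp only: of_real_sum complex_norm_square)
  have "l2_inner M (\<lambda>x. h x - s x) (\<lambda>x. h x - s x) =
      cnj (l2_inner M h (\<lambda>x. h x - s x)) - cnj (l2_inner M s (\<lambda>x. h x - s x))"
    using l2_inner_diff_right[OF d h s]
    by (simp add: l2_inner_commute[of M "\<lambda>x. h x - s x" h] l2_inner_commute[of M "\<lambda>x. h x - s x" s])
  also have "\<dots> = l2_inner M h h - complex_of_real (\<Sum>i<n. (cmod (c i))\<^sup>2)"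
  proof -
    have "l2_inner M s h = complex_of_real (\<Sum>i<n. (cmod (c i))\<^sup>2)"
      by (subst l2_inner_commute) (simp only: hs sq complex_cnj_complex_of_real)
    then show ?thesis
      unfolding l2_inner_diff_right[OF h h s] l2_inner_diff_right[OF s h s] ss hs sq
      by (simp add: l2_inner_self del: of_real_sum)
  qed
  finally have "complex_of_real (LINT x|M. (cmod (h x - s x))\<^sup>2) =
      complex_of_real ((LINT x|M. (cmod (h x))\<^sup>2) - (\<Sum>i<n. (cmod (c i))\<^sup>2))"
    by (simp add: l2_inner_self)
  then have "(LINT x|M. (cmod (h x - s x))\<^sup>2) = (LINT x|M. (cmod (h x))\<^sup>2) - (\<Sum>i<n. (cmod (c i))\<^sup>2)"
    by (simp only: of_real_eq_iff)
  moreover have "0 \<le> (LINT x|M. (cmod (h x - s x))\<^sup>2)"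
    by (rule Bochner_Integration.integral_nonneg) simp
  ultimately show ?thesis by (simp add: c_def)
qed

lemma L2_ell2_iff: "v \<in> L2 ell2_measure \<longleftrightarrow> summable (\<lambda>i. (cmod (v i))\<^sup>2)"
  by (simp add: L2_def integrable_count_space_nat_iff)

lemma L2_ell2_bounded:
  assumes "\<And>n. (\<Sum>i<n. (cmod (v i))\<^sup>2) \<le> B"
  shows "v \<in> L2 ell2_measure"
  unfolding L2_ell2_iff by (rule summableI_nonneg_bounded[OF _ assms]) simp

text \<open>The operator is symmetric, so \<open>z \<parallel>\<phi>\<parallel>\<^sup>2\<close> and its complex conjugate agree.\<close>

lemma self_adjoint_no_nonreal_eigenvalue:
  assumes sa: "self_adjoint M A" and ev: "(\<phi>, \<lambda>x. z * \<phi> x) \<in> A" and z: "Im z \<noteq> 0"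
  shows "(LINT x|M. (cmod (\<phi> x))\<^sup>2) = 0"
proof -
  have "(\<phi>, \<lambda>x. z * \<phi> x) \<in> op_adjoint M A" using sa ev by (simp add: self_adjoint_def)
  with ev have "l2_inner M \<phi> (\<lambda>x. z * \<phi> x) = l2_inner M (\<lambda>x. z * \<phi> x) \<phi>"
    by (fastforce simp: op_adjoint_def)
  moreover have "l2_inner M \<phi> (\<lambda>x. z * \<phi> x) = z * l2_inner M \<phi> \<phi>"
    by (simp add: l2_inner_def mult.left_commute)
  moreover have "l2_inner M (\<lambda>x. z * \<phi> x) \<phi> = cnj z * l2_inner M \<phi> \<phi>"
    by (simp add: l2_inner_def mult.assoc)
  ultimately have "(z - cnj z) * l2_inner M \<phi> \<phi> = 0"
    by (simp add: left_diff_distrib)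
  moreover have "z - cnj z \<noteq> 0" using z by (simp add: complex_eq_iff)
  ultimately show ?thesis by (simp add: l2_inner_self)
qed

section \<open>The spectral family of a multiplication operator\<close>

definition spectral_cut :: "('a \<Rightarrow> real) \<Rightarrow> real \<Rightarrow> ('a \<Rightarrow> complex) \<Rightarrow> 'a \<Rightarrow> complex" where
  "spectral_cut g t \<phi> = (\<lambda>x. if g x \<le> t then \<phi> x else 0)"

text \<open>The measure whose integrals are the quadratic forms \<open>\<langle>\<phi>, h(g) \<phi>\<rangle>\<close>.\<close>

definition spectral_measure :: "'a measure \<Rightarrow> ('a \<Rightarrow> real) \<Rightarrow> ('a \<Rightarrow> complex) \<Rightarrow> real measure" where
  "spectral_measure M g \<phi> = distr (density M (\<lambda>x. ennreal ((cmod (\<phi> x))\<^sup>2))) borel g"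

context
  fixes M :: "'a measure" and g :: "'a \<Rightarrow> real"
  assumes g [measurable]: "g \<in> borel_measurable M"
begin

lemma spectral_cut_L2: "\<phi> \<in> L2 M \<Longrightarrow> spectral_cut g t \<phi> \<in> L2 M"
proof -
  assume \<phi>: "\<phi> \<in> L2 M"
  note [measurable] = L2_measurable[OF this]
  have "integrable M (\<lambda>x. (cmod (spectral_cut g t \<phi> x))\<^sup>2)"
  proof (rule Bochner_Integration.integrable_bound)
    show "integrable M (\<lambda>x. (cmod (\<phi> x))\<^sup>2)" using \<phi> by (simp add: L2_def)
  qed (auto simp: spectral_cut_def)
  then show ?thesis by (simp add: L2_def spectral_cut_def)
qed

lemma
  fixes h :: "real \<Rightarrow> real"
  assumes \<phi>: "\<phi> \<in> L2 M"
  shows finite_borel_spectral_measure: "finite_borel_measure (spectral_measure M g \<phi>)"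
    and integrable_spectral_measure: "h \<in> borel_measurable borel \<Longrightarrow>
      integrable (spectral_measure M g \<phi>) h \<longleftrightarrow> integrable M (\<lambda>x. (cmod (\<phi> x))\<^sup>2 * h (g x))"
    and integral_spectral_measure: "h \<in> borel_measurable borel \<Longrightarrow>
      (LINT t|spectral_measure M g \<phi>. h t) = (LINT x|M. (cmod (\<phi> x))\<^sup>2 * h (g x))"
proof -
  note [measurable] = L2_measurable[OF \<phi>]
  let ?D = "density M (\<lambda>x. ennreal ((cmod (\<phi> x))\<^sup>2))"
  have int: "integrable M (\<lambda>x. (cmod (\<phi> x))\<^sup>2)" using \<phi> by (simp add: L2_def)
  have "emeasure ?D (space ?D) < \<infinity>"
    using nn_integral_eq_integral[OF int] by (simp add: emeasure_density cong: nn_integral_cong)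
  then have "finite_measure ?D" by (intro finite_measureI) auto
  then interpret finite_measure "spectral_measure M g \<phi>"
    unfolding spectral_measure_def by (rule finite_measure.finite_measure_distr) simp
  show "finite_borel_measure (spectral_measure M g \<phi>)"
    by unfold_locales (simp add: spectral_measure_def)
  show "integrable (spectral_measure M g \<phi>) h \<longleftrightarrow> integrable M (\<lambda>x. (cmod (\<phi> x))\<^sup>2 * h (g x))"
    if [measurable]: "h \<in> borel_measurable borel"
    unfolding spectral_measure_def by (simp add: integrable_distr_eq integrable_density)
  show "(LINT t|spectral_measure M g \<phi>. h t) = (LINT x|M. (cmod (\<phi> x))\<^sup>2 * h (g x))"
    if [measurable]: "h \<in> borel_measurable borel"
    unfolding spectral_measure_def by (simp add: integral_distr integral_density)
qed

lemma cdf_spectral_measure: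
  assumes \<phi>: "\<phi> \<in> L2 M"
  shows "cdf (spectral_measure M g \<phi>) t = (LINT x|M. (cmod (spectral_cut g t \<phi> x))\<^sup>2)"
proof -
  have "cdf (spectral_measure M g \<phi>) t = (LINT s|spectral_measure M g \<phi>. indicator {..t} s)"
    by (simp add: cdf_def spectral_measure_def)
  also have "\<dots> = (LINT x|M. (cmod (\<phi> x))\<^sup>2 * indicator {..t} (g x))"
    using integral_spectral_measure[OF \<phi>, of "indicator {..t}"] by simp
  also have "\<dots> = (LINT x|M. (cmod (spectral_cut g t \<phi> x))\<^sup>2)"
    by (intro Bochner_Integration.integral_cong) (auto simp: spectral_cut_def)
  finally show ?thesis .
qed

lemma spectral_distr_cut:
  assumes \<phi>: "\<phi> \<in> L2 M"
  shows "spectral_distr M (spectral_cut g) \<phi> = cdf (spectral_measure M g \<phi>)"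
  by (rule ext) (simp add: spectral_distr_def l2_norm_def cdf_spectral_measure[OF \<phi>])

text \<open>Reduces integrals against the Stieltjes measure in the definition of a spectral family to integrals
over the original measure space.\<close>

lemma interval_measure_spectral_distr:
  assumes \<phi>: "\<phi> \<in> L2 M"
  shows "interval_measure (spectral_distr M (spectral_cut g) \<phi>) = spectral_measure M g \<phi>"
proof -
  interpret finite_borel_measure "spectral_measure M g \<phi>"
    using finite_borel_spectral_measure[OF \<phi>] .
  let ?F = "cdf (spectral_measure M g \<phi>)"
  have "finite_borel_measure (interval_measure ?F)"
    by (rule finite_borel_measure_interval_measure[OF cdf_nondecreasing cdf_is_right_cont
        cdf_lim_at_bot cdf_lim_at_top measure_nonneg])
  moreover have "cdf (interval_measure ?F) = ?F"
    by (rule cdf_interval_measure[OF cdf_nondecreasing cdf_is_right_cont cdf_lim_at_bot])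
  ultimately show ?thesis
    unfolding spectral_distr_cut[OF \<phi>]
    using cdf_unique' finite_borel_spectral_measure[OF \<phi>] by blast
qed

lemma l2_norm_spectral_cut_diff:
  assumes \<phi>: "\<phi> \<in> L2 M" and st: "t \<le> s"
  shows "l2_norm M (\<lambda>x. spectral_cut g s \<phi> x - spectral_cut g t \<phi> x) =
    sqrt (cdf (spectral_measure M g \<phi>) s - cdf (spectral_measure M g \<phi>) t)"
proof -
  have int: "integrable M (\<lambda>x. (cmod (spectral_cut g r \<phi> x))\<^sup>2)" for r
    using spectral_cut_L2[OF \<phi>] by (simp add: L2_def)
  have "(LINT x|M. (cmod (spectral_cut g s \<phi> x - spectral_cut g t \<phi> x))\<^sup>2) =
      (LINT x|M. (cmod (spectral_cut g s \<phi> x))\<^sup>2 - (cmod (spectral_cut g t \<phi> x))\<^sup>2)"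
    using st by (intro Bochner_Integration.integral_cong) (auto simp: spectral_cut_def)
  then show ?thesis
    by (simp add: l2_norm_def cdf_spectral_measure[OF \<phi>] int)
qed

lemma l2_norm_spectral_cut_complement:
  assumes \<phi>: "\<phi> \<in> L2 M"
  shows "l2_norm M (\<lambda>x. \<phi> x - spectral_cut g t \<phi> x) =
    sqrt (measure (spectral_measure M g \<phi>) (space (spectral_measure M g \<phi>)) - cdf (spectral_measure M g \<phi>) t)"
proof -
  have int: "integrable M (\<lambda>x. (cmod (spectral_cut g t \<phi> x))\<^sup>2)" "integrable M (\<lambda>x. (cmod (\<phi> x))\<^sup>2)"
    using spectral_cut_L2[OF \<phi>] \<phi> by (simp_all add: L2_def)
  have "measure (spectral_measure M g \<phi>) (space (spectral_measure M g \<phi>)) = (LINT s|spectral_measure M g \<phi>. 1)"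
    by simp
  also have "\<dots> = (LINT x|M. (cmod (\<phi> x))\<^sup>2)"
    using integral_spectral_measure[OF \<phi>, of "\<lambda>_. 1"] by simp
  finally have total: "measure (spectral_measure M g \<phi>) (space (spectral_measure M g \<phi>)) = (LINT x|M. (cmod (\<phi> x))\<^sup>2)" .
  have "(LINT x|M. (cmod (\<phi> x - spectral_cut g t \<phi> x))\<^sup>2) =
      (LINT x|M. (cmod (\<phi> x))\<^sup>2 - (cmod (spectral_cut g t \<phi> x))\<^sup>2)"
    by (intro Bochner_Integration.integral_cong) (auto simp: spectral_cut_def)
  then show ?thesis
    by (simp add: l2_norm_def cdf_spectral_measure[OF \<phi>] int total)
qed

lemma spectral_resolution_cut: "spectral_resolution M (spectral_cut g)"
  unfolding spectral_resolution_def
proof (intro conjI allI ballI impI)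
  show "orth_projection M (spectral_cut g t)" for t
    unfolding orth_projection_def
  proof (intro conjI ballI)
    fix \<phi> \<psi> assume "\<phi> \<in> L2 M" "\<psi> \<in> L2 M"
    show "spectral_cut g t \<phi> \<in> L2 M" by (rule spectral_cut_L2) fact
    show "AE x in M. spectral_cut g t (spectral_cut g t \<phi>) x = spectral_cut g t \<phi> x"
      by (simp add: spectral_cut_def)
    show "l2_inner M (spectral_cut g t \<phi>) \<psi> = l2_inner M \<phi> (spectral_cut g t \<psi>)"
      unfolding l2_inner_def by (intro Bochner_Integration.integral_cong) (auto simp: spectral_cut_def)
  qed
next
  fix s t :: real and \<phi> assume "s \<le> t"
  then show "AE x in M. spectral_cut g s (spectral_cut g t \<phi>) x = spectral_cut g s \<phi> x"
    by (auto simp: spectral_cut_def)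
next
  fix t and \<phi> assume \<phi>: "\<phi> \<in> L2 M"
  interpret finite_borel_measure "spectral_measure M g \<phi>"
    using finite_borel_spectral_measure[OF \<phi>] .
  let ?F = "cdf (spectral_measure M g \<phi>)"
  have "((\<lambda>s. sqrt (?F s - ?F t)) \<longlongrightarrow> sqrt (?F t - ?F t)) (at_right t)"
    using cdf_is_right_cont[of t] unfolding continuous_within by (intro tendsto_intros)
  moreover have "eventually (\<lambda>s. sqrt (?F s - ?F t) =
      l2_norm M (\<lambda>x. spectral_cut g s \<phi> x - spectral_cut g t \<phi> x)) (at_right t)"
    unfolding eventually_at_right_field
    by (intro exI[of _ "t + 1"]) (auto simp: l2_norm_spectral_cut_diff[OF \<phi>])
  ultimately show "((\<lambda>s. l2_norm M (\<lambda>x. spectral_cut g s \<phi> x - spectral_cut g t \<phi> x)) \<longlongrightarrow> 0) (at_right t)"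
    by (simp add: tendsto_cong)
next
  fix \<phi> assume \<phi>: "\<phi> \<in> L2 M"
  interpret finite_borel_measure "spectral_measure M g \<phi>"
    using finite_borel_spectral_measure[OF \<phi>] .
  let ?F = "cdf (spectral_measure M g \<phi>)" and ?m = "measure (spectral_measure M g \<phi>) (space (spectral_measure M g \<phi>))"
  have "((\<lambda>t. sqrt (?F t)) \<longlongrightarrow> sqrt 0) at_bot"
    using cdf_lim_at_bot by (intro tendsto_intros)
  then show "((\<lambda>t. l2_norm M (spectral_cut g t \<phi>)) \<longlongrightarrow> 0) at_bot"
    by (simp add: l2_norm_def cdf_spectral_measure[OF \<phi>])
  have "((\<lambda>t. sqrt (?m - ?F t)) \<longlongrightarrow> sqrt (?m - ?m)) at_top"
    using cdf_lim_at_top by (intro tendsto_intros)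
  then show "((\<lambda>t. l2_norm M (\<lambda>x. \<phi> x - spectral_cut g t \<phi> x)) \<longlongrightarrow> 0) at_top"
    by (simp add: l2_norm_spectral_cut_complement[OF \<phi>])
qed

lemma mult_op_domain:
  "Domain (mult_op M g) = {\<phi> \<in> L2 M. integrable M (\<lambda>x. (cmod (\<phi> x))\<^sup>2 * (g x)\<^sup>2)}"
proof (rule subset_antisym; rule subsetI)
  fix \<phi> assume "\<phi> \<in> Domain (mult_op M g)"
  then obtain \<eta> where \<eta>: "\<phi> \<in> L2 M" "\<eta> \<in> L2 M" "AE x in M. \<eta> x = complex_of_real (g x) * \<phi> x"
    by (auto simp: mult_op_def)
  note [measurable] = L2_measurable[OF \<eta>(1)] L2_measurable[OF \<eta>(2)]
  have "integrable M (\<lambda>x. (cmod (\<phi> x))\<^sup>2 * (g x)\<^sup>2) \<longleftrightarrow> integrable M (\<lambda>x. (cmod (\<eta> x))\<^sup>2)"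
    using \<eta>(3) by (intro integrable_cong_AE) (auto simp: norm_mult power_mult_distrib)
  then show "\<phi> \<in> {\<phi> \<in> L2 M. integrable M (\<lambda>x. (cmod (\<phi> x))\<^sup>2 * (g x)\<^sup>2)}"
    using \<eta> by (simp add: L2_def)
next
  fix \<phi> assume "\<phi> \<in> {\<phi> \<in> L2 M. integrable M (\<lambda>x. (cmod (\<phi> x))\<^sup>2 * (g x)\<^sup>2)}"
  then have \<phi>: "\<phi> \<in> L2 M" and int: "integrable M (\<lambda>x. (cmod (\<phi> x))\<^sup>2 * (g x)\<^sup>2)" by auto
  note [measurable] = L2_measurable[OF \<phi>]
  have "(\<lambda>x. complex_of_real (g x) * \<phi> x) \<in> L2 M"
    using int by (simp add: L2_def norm_mult power_mult_distrib mult.commute)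
  with \<phi> show "\<phi> \<in> Domain (mult_op M g)"
    by (auto simp: mult_op_def intro!: DomainI)
qed

text \<open>Pushed forward along \<open>g\<close>, the density \<open>\<bar>\<phi>\<bar>\<^sup>2\<close> turns every condition on the spectral family into a
property of the distribution function of a finite measure on the line.\<close>

theorem spectral_family_mult_op: "spectral_family M (mult_op M g) (spectral_cut g)"
  unfolding spectral_family_def
proof (intro conjI spectral_resolution_cut ballI)
  have "integrable (interval_measure (spectral_distr M (spectral_cut g) \<phi>)) (\<lambda>t. t\<^sup>2) \<longleftrightarrow>
      integrable M (\<lambda>x. (cmod (\<phi> x))\<^sup>2 * (g x)\<^sup>2)" if "\<phi> \<in> L2 M" for \<phi>
    unfolding interval_measure_spectral_distr[OF that]
    by (rule integrable_spectral_measure[OF that]) simp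
  then show "Domain (mult_op M g) = {\<phi> \<in> L2 M.
      integrable (interval_measure (spectral_distr M (spectral_cut g) \<phi>)) (\<lambda>t. t\<^sup>2)}"
    unfolding mult_op_domain by blast
next
  fix z assume "z \<in> mult_op M g"
  then obtain \<phi> \<eta> where z: "z = (\<phi>, \<eta>)"
    and \<eta>: "\<phi> \<in> L2 M" "\<eta> \<in> L2 M" "AE x in M. \<eta> x = complex_of_real (g x) * \<phi> x"
    by (auto simp: mult_op_def)
  note [measurable] = L2_measurable[OF \<eta>(1)] L2_measurable[OF \<eta>(2)]
  have [measurable]: "(\<lambda>x. cnj (\<phi> x)) \<in> borel_measurable M"
    by (rule borel_measurable_continuous_on[of cnj]) (auto intro: continuous_intros L2_measurable \<eta>)
  have "l2_inner M \<phi> \<eta> = (LINT x|M. complex_of_real ((cmod (\<phi> x))\<^sup>2 * g x))"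
    unfolding l2_inner_def
  proof (rule integral_cong_AE)
    show "AE x in M. cnj (\<phi> x) * \<eta> x = complex_of_real ((cmod (\<phi> x))\<^sup>2 * g x)"
      using \<eta>(3)
    proof eventually_elim
      case (elim x)
      then show ?case
        using complex_norm_square[of "\<phi> x"] by (simp add: mult_ac)
    qed
  qed simp_all
  also have "\<dots> = complex_of_real (LINT x|M. (cmod (\<phi> x))\<^sup>2 * g x)"
    by (rule integral_complex_of_real)
  also have "(LINT x|M. (cmod (\<phi> x))\<^sup>2 * g x) =
      (LINT t|interval_measure (spectral_distr M (spectral_cut g) \<phi>). t)"
    unfolding interval_measure_spectral_distr[OF \<eta>(1)]
    by (rule integral_spectral_measure[OF \<eta>(1), symmetric]) simp
  finally show "case z of (\<phi>, \<eta>) \<Rightarrow> l2_inner M \<phi> \<eta> =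
      complex_of_real (LINT t|interval_measure (spectral_distr M (spectral_cut g) \<phi>). t)"
    by (simp add: z)
qed

lemma op_eigenvalue_mult_op_atom:
  assumes "op_eigenvalue M (mult_op M g) c"
  shows "\<not> (AE x in M. g x \<noteq> c)"
proof
  assume "AE x in M. g x \<noteq> c"
  moreover obtain \<phi> where "\<not> (AE x in M. \<phi> x = 0)"
    "AE x in M. complex_of_real c * \<phi> x = complex_of_real (g x) * \<phi> x"
    using assms by (auto simp: op_eigenvalue_def mult_op_def)
  ultimately show False
    by (auto elim: eventually_elim2 simp del: eq_iff_diff_eq_0) (smt (verit) AE_mp AE_I2 mult_cancel_right of_real_eq_iff)
qed

end

section \<open>Stieltjes convergence of quadrature sums\<close>

definition poisson :: "real \<Rightarrow> real \<Rightarrow> real \<Rightarrow> real" where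
  "poisson y s x = y / ((x - s)\<^sup>2 + y\<^sup>2)"

text \<open>The Lipschitz constant does not depend on the evaluation point \<open>x\<close>; this makes the Riemann sums below
converge uniformly.\<close>

lemma poisson_lipschitz:
  assumes y: "y > 0"
  shows "\<bar>poisson y u x - poisson y v x\<bar> \<le> \<bar>u - v\<bar> / y\<^sup>2"
proof -
  define p q where "p = x - u" and "q = x - v"
  have pos: "0 < p\<^sup>2 + y\<^sup>2" "0 < q\<^sup>2 + y\<^sup>2"
    using y by (simp_all add: add_nonneg_pos)
  have half: "\<bar>r\<bar> * y \<le> (r\<^sup>2 + y\<^sup>2) / 2" for r
    using sum_squares_bound[of "\<bar>r\<bar>" y] by simp
  have "\<bar>p + q\<bar> * y ^ 3 \<le> (\<bar>p\<bar> * y) * y\<^sup>2 + (\<bar>q\<bar> * y) * y\<^sup>2"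
    using y abs_triangle_ineq[of p q] mult_right_mono[of "\<bar>p + q\<bar>" "\<bar>p\<bar> + \<bar>q\<bar>" "y ^ 3"]
    by (simp add: power3_eq_cube power2_eq_square algebra_simps)
  also have "\<dots> \<le> ((p\<^sup>2 + y\<^sup>2) / 2) * (q\<^sup>2 + y\<^sup>2) + ((q\<^sup>2 + y\<^sup>2) / 2) * (p\<^sup>2 + y\<^sup>2)"
    using half[of p] half[of q] y by (intro add_mono mult_mono) auto
  finally have key: "\<bar>p + q\<bar> * y ^ 3 \<le> (p\<^sup>2 + y\<^sup>2) * (q\<^sup>2 + y\<^sup>2)"
    by (simp add: field_simps)
  have "poisson y u x - poisson y v x = (y * (q\<^sup>2 + y\<^sup>2) - y * (p\<^sup>2 + y\<^sup>2)) / ((p\<^sup>2 + y\<^sup>2) * (q\<^sup>2 + y\<^sup>2))"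
    using pos unfolding poisson_def p_def[symmetric] q_def[symmetric] by (intro diff_frac_eq) auto
  also have "y * (q\<^sup>2 + y\<^sup>2) - y * (p\<^sup>2 + y\<^sup>2) = (u - v) * ((p + q) * y)"
    by (simp add: p_def q_def algebra_simps power2_eq_square)
  finally have "poisson y u x - poisson y v x = (u - v) * ((p + q) * y) / ((p\<^sup>2 + y\<^sup>2) * (q\<^sup>2 + y\<^sup>2))" .
  then have "\<bar>poisson y u x - poisson y v x\<bar> = \<bar>u - v\<bar> * ((\<bar>p + q\<bar> * y) / ((p\<^sup>2 + y\<^sup>2) * (q\<^sup>2 + y\<^sup>2)))"
    using pos y by (simp add: abs_mult)
  also have "(\<bar>p + q\<bar> * y) / ((p\<^sup>2 + y\<^sup>2) * (q\<^sup>2 + y\<^sup>2)) \<le> 1 / y\<^sup>2"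
  proof -
    have "(\<bar>p + q\<bar> * y ^ 3) / ((p\<^sup>2 + y\<^sup>2) * (q\<^sup>2 + y\<^sup>2)) \<le> 1"
      using key mult_pos_pos[OF pos] by (simp add: divide_le_eq_1_pos)
    from divide_right_mono[OF this, of "y\<^sup>2"] show ?thesis
      using y by (simp add: power3_eq_cube power2_eq_square)
  qed
  finally show ?thesis
    by (simp add: mult_left_mono)
qed

text \<open>The Poisson kernel is the derivative of the arctangent in the parameter \<open>s\<close>; summed over a partition,
the error of order \<open>h\<^sup>2\<close> still tends to 0.\<close>

lemma arctan_step_poisson:
  assumes y: "y > 0" and h: "h > 0"
  shows "\<bar>arctan ((s + h - x) / y) - arctan ((s - x) / y) - h * poisson y s x\<bar> \<le> h\<^sup>2 / y\<^sup>2"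
proof -
  have der: "((\<lambda>u. arctan ((u - x) / y)) has_real_derivative poisson y u x) (at u)" for u
  proof -
    have "((\<lambda>u. arctan ((u - x) / y)) has_real_derivative (1 / y) / (1 + ((u - x) / y)\<^sup>2)) (at u)"
      using y by (auto intro!: derivative_eq_intros simp: field_simps)
    also have "(1 / y) / (1 + ((u - x) / y)\<^sup>2) = poisson y u x"
      using y unfolding poisson_def
      by (simp add: field_simps power2_eq_square)
    finally show ?thesis .
  qed
  obtain z where z: "s < z" "z < s + h"
    "arctan ((s + h - x) / y) - arctan ((s - x) / y) = (s + h - s) * poisson y z x"
    using MVT2[of s "s + h" "\<lambda>u. arctan ((u - x) / y)" "\<lambda>u. poisson y u x"] der h by auto
  have "\<bar>h * poisson y z x - h * poisson y s x\<bar> = h * \<bar>poisson y z x - poisson y s x\<bar>"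
    using h by (simp add: abs_mult flip: right_diff_distrib)
  also have "\<dots> \<le> h * (\<bar>z - s\<bar> / y\<^sup>2)"
    using h poisson_lipschitz[OF y] by (intro mult_left_mono) auto
  also have "\<dots> \<le> h * (h / y\<^sup>2)"
    using h z by (intro mult_left_mono divide_right_mono) auto
  finally show ?thesis
    using z by (simp add: power2_eq_square)
qed

locale quadrature = real_distribution \<mu> for \<mu> :: "real measure" +
  fixes weight node :: "nat \<Rightarrow> nat \<Rightarrow> real"
  assumes weight_nonneg: "k \<le> n \<Longrightarrow> 0 \<le> weight n k"
    and weight_sum: "(\<Sum>k\<le>n. weight n k) = 1"
begin

definition quad :: "nat \<Rightarrow> (real \<Rightarrow> real) \<Rightarrow> real" where
  "quad n h = (\<Sum>k\<le>n. weight n k * h (node n k))"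

definition converges :: "(real \<Rightarrow> real) \<Rightarrow> bool" where
  "converges h \<longleftrightarrow> integrable \<mu> h \<and> (\<lambda>n. quad n h) \<longlonglongrightarrow> (LINT x|\<mu>. h x)"

lemma quad_mono: "(\<And>x. h x \<le> h' x) \<Longrightarrow> quad n h \<le> quad n h'"
  unfolding quad_def by (intro sum_mono mult_left_mono weight_nonneg) auto

lemma converges_const: "converges (\<lambda>_. c)"
proof -
  have "quad n (\<lambda>_. c) = c" for n
    by (simp add: quad_def weight_sum flip: sum_distrib_right)
  then show ?thesis
    by (simp add: converges_def prob_space[unfolded space_eq_univ])
qed

lemma converges_add: "converges h \<Longrightarrow> converges h' \<Longrightarrow> converges (\<lambda>x. h x + h' x)"
  by (auto simp: converges_def quad_def distrib_left sum.distrib intro!: tendsto_add)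

lemma converges_cmult: "converges h \<Longrightarrow> converges (\<lambda>x. c * h x)"
proof -
  have "quad n (\<lambda>x. c * h x) = c * quad n h" for n
    by (simp add: quad_def sum_distrib_left algebra_simps)
  then show "converges h \<Longrightarrow> ?thesis"
    by (auto simp: converges_def intro!: tendsto_mult)
qed

lemma converges_diff: "converges h \<Longrightarrow> converges h' \<Longrightarrow> converges (\<lambda>x. h x - h' x)"
  using converges_add[of h "\<lambda>x. (-1) * h' x"] converges_cmult[of h' "-1"] by simp

lemma converges_sum:
  "finite I \<Longrightarrow> (\<And>i. i \<in> I \<Longrightarrow> converges (h i)) \<Longrightarrow> converges (\<lambda>x. \<Sum>i\<in>I. h i x)"
  by (induction I rule: finite_induct) (auto intro!: converges_add converges_const[of 0])

text \<open>Stated for arbitrary \<open>h\<close> and an arbitrary number \<open>I\<close> between the integrals, because it is applied to a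
function that need not be Borel measurable.\<close>

lemma quad_sandwich:
  assumes "\<And>\<epsilon>. \<epsilon> > 0 \<Longrightarrow> \<exists>l u. converges l \<and> converges u \<and> (\<forall>x. l x \<le> h x \<and> h x \<le> u x) \<and>
    (LINT x|\<mu>. l x) \<le> I \<and> I \<le> (LINT x|\<mu>. u x) \<and> (LINT x|\<mu>. u x) - (LINT x|\<mu>. l x) < \<epsilon>"
  shows "(\<lambda>n. quad n h) \<longlonglongrightarrow> I"
proof (rule order_tendstoI)
  fix c assume "c < I"
  then obtain l u where lu: "converges l" "\<And>x. l x \<le> h x" "I \<le> (LINT x|\<mu>. u x)"
    "(LINT x|\<mu>. u x) - (LINT x|\<mu>. l x) < I - c"
    using assms[of "I - c"] by auto
  then have "c < (LINT x|\<mu>. l x)" by linarith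
  with lu(1) have "eventually (\<lambda>n. c < quad n l) sequentially"
    unfolding converges_def by (blast dest: order_tendstoD)
  then show "eventually (\<lambda>n. c < quad n h) sequentially"
    by eventually_elim (rule less_le_trans[OF _ quad_mono[OF lu(2)]])
next
  fix c assume "I < c"
  then obtain l u where lu: "converges u" "\<And>x. h x \<le> u x" "(LINT x|\<mu>. l x) \<le> I"
    "(LINT x|\<mu>. u x) - (LINT x|\<mu>. l x) < c - I"
    using assms[of "c - I"] by auto
  then have "(LINT x|\<mu>. u x) < c" by linarith
  with lu(1) have "eventually (\<lambda>n. quad n u < c) sequentially"
    unfolding converges_def by (blast dest: order_tendstoD)
  then show "eventually (\<lambda>n. quad n h < c) sequentially"
    by eventually_elim (rule le_less_trans[OF quad_mono[OF lu(2)]])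
qed

lemma converges_sandwich:
  assumes h: "h \<in> borel_measurable borel"
    and *: "\<And>\<epsilon>. \<epsilon> > 0 \<Longrightarrow> \<exists>l u. converges l \<and> converges u \<and> (\<forall>x. l x \<le> h x \<and> h x \<le> u x) \<and>
      (LINT x|\<mu>. u x) - (LINT x|\<mu>. l x) < \<epsilon>"
  shows "converges h"
proof -
  have hm: "h \<in> borel_measurable \<mu>" using h by simp
  obtain l u where lu: "converges l" "converges u" "\<And>x. l x \<le> h x" "\<And>x. h x \<le> u x"
    using *[of 1] by auto
  have int: "integrable \<mu> h"
  proof (rule Bochner_Integration.integrable_bound)
    show "integrable \<mu> (\<lambda>x. \<bar>l x\<bar> + \<bar>u x\<bar>)"
      using lu by (auto simp: converges_def)
    show "AE x in \<mu>. norm (h x) \<le> norm (\<bar>l x\<bar> + \<bar>u x\<bar>)"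
    proof (rule AE_I2)
      fix x show "norm (h x) \<le> norm (\<bar>l x\<bar> + \<bar>u x\<bar>)"
        using lu(3,4)[of x] by auto
    qed
  qed (rule hm)
  have "(\<lambda>n. quad n h) \<longlonglongrightarrow> (LINT x|\<mu>. h x)"
  proof (rule quad_sandwich)
    fix \<epsilon> :: real assume "\<epsilon> > 0"
    from *[OF this] obtain l u where lu: "converges l" "converges u" "\<And>x. l x \<le> h x" "\<And>x. h x \<le> u x"
      "(LINT x|\<mu>. u x) - (LINT x|\<mu>. l x) < \<epsilon>" by blast
    moreover have "(LINT x|\<mu>. l x) \<le> (LINT x|\<mu>. h x)" "(LINT x|\<mu>. h x) \<le> (LINT x|\<mu>. u x)"
      using lu int by (auto simp: converges_def intro!: integral_mono)
    ultimately show "\<exists>l u. converges l \<and> converges u \<and> (\<forall>x. l x \<le> h x \<and> h x \<le> u x) \<and>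
      (LINT x|\<mu>. l x) \<le> (LINT x|\<mu>. h x) \<and> (LINT x|\<mu>. h x) \<le> (LINT x|\<mu>. u x) \<and>
      (LINT x|\<mu>. u x) - (LINT x|\<mu>. l x) < \<epsilon>"
      by blast
  qed
  with int show ?thesis by (simp add: converges_def)
qed

lemma converges_uniform_limit:
  assumes "h \<in> borel_measurable borel"
    and approx: "\<And>\<epsilon>. \<epsilon> > 0 \<Longrightarrow> \<exists>h'. converges h' \<and> (\<forall>x. \<bar>h x - h' x\<bar> \<le> \<epsilon>)"
  shows "converges h"
proof (rule converges_sandwich[OF assms(1)])
  fix \<epsilon> :: real assume "\<epsilon> > 0"
  with approx[of "\<epsilon> / 3"] obtain h' where h': "converges h'" "\<And>x. \<bar>h x - h' x\<bar> \<le> \<epsilon> / 3"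
    by auto
  show "\<exists>l u. converges l \<and> converges u \<and> (\<forall>x. l x \<le> h x \<and> h x \<le> u x) \<and>
      (LINT x|\<mu>. u x) - (LINT x|\<mu>. l x) < \<epsilon>"
  proof (intro exI conjI allI)
    show "converges (\<lambda>x. h' x - \<epsilon> / 3)" "converges (\<lambda>x. h' x + \<epsilon> / 3)"
      using h'(1) converges_const by (auto intro: converges_add converges_diff)
    show "h' x - \<epsilon> / 3 \<le> h x" "h x \<le> h' x + \<epsilon> / 3" for x
      using h'(2)[of x] by linarith+
    have "integrable \<mu> h'" using h'(1) by (simp add: converges_def)
    then show "(LINT x|\<mu>. h' x + \<epsilon> / 3) - (LINT x|\<mu>. h' x - \<epsilon> / 3) < \<epsilon>"
      using \<open>\<epsilon> > 0\<close> by (simp add: prob_space[unfolded space_eq_univ])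
  qed
qed

end

text \<open>Convergence on Poisson kernels is convergence of the imaginary parts of the Stieltjes transforms in the
upper half plane.\<close>

locale poisson_quadrature = quadrature +
  assumes converges_poisson: "y > 0 \<Longrightarrow> converges (poisson y s)"
begin

text \<open>A difference of arctangents is the integral of Poisson kernels over an interval, hence a uniform limit
of Riemann sums.\<close>

lemma converges_arctan_diff:
  assumes y: "y > 0"
  shows "converges (\<lambda>x. arctan ((t - x) / y) - arctan ((s - x) / y))"
proof -
  have main: "converges (\<lambda>x. arctan ((t - x) / y) - arctan ((s - x) / y))" if st: "s < t" for s t
  proof (rule converges_uniform_limit)
    fix \<epsilon> :: real assume \<epsilon>: "\<epsilon> > 0"
    obtain N :: nat where N: "N > 0" "(t - s)\<^sup>2 / (\<epsilon> * y\<^sup>2) < real N"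
      using reals_Archimedean2[of "(t - s)\<^sup>2 / (\<epsilon> * y\<^sup>2)"] \<epsilon> y
      by (metis divide_nonneg_nonneg less_eq_real_def mult_nonneg_nonneg of_nat_0_less_iff
        order_le_less_trans zero_le_power2)
    define h where "h = (t - s) / N"
    have h: "h > 0" using st N by (simp add: h_def)
    let ?R = "\<lambda>x. \<Sum>i<N. h * poisson y (s + i * h) x"
    have "\<bar>arctan ((t - x) / y) - arctan ((s - x) / y) - ?R x\<bar> \<le> \<epsilon>" for x
    proof -
      let ?A = "\<lambda>i. arctan ((s + real i * h - x) / y)"
      have "?A N - ?A 0 = (\<Sum>i<N. ?A (Suc i) - ?A i)"
        by (rule sum_lessThan_telescope[symmetric])
      moreover have "s + real N * h = t" using N by (simp add: h_def)
      ultimately have "\<bar>arctan ((t - x) / y) - arctan ((s - x) / y) - ?R x\<bar> =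
          \<bar>\<Sum>i<N. ?A (Suc i) - ?A i - h * poisson y (s + i * h) x\<bar>"
        by (simp add: sum_subtractf)
      also have "\<dots> \<le> (\<Sum>i<N. \<bar>?A (Suc i) - ?A i - h * poisson y (s + i * h) x\<bar>)"
        by (rule sum_abs)
      also have "\<dots> \<le> (\<Sum>i<N. h\<^sup>2 / y\<^sup>2)"
      proof (rule sum_mono)
        fix i
        have "s + real (Suc i) * h = s + real i * h + h" by (simp add: algebra_simps)
        then show "\<bar>?A (Suc i) - ?A i - h * poisson y (s + i * h) x\<bar> \<le> h\<^sup>2 / y\<^sup>2"
          using arctan_step_poisson[OF y h, of "s + i * h" x] by (simp add: add.assoc)
      qed
      also have "\<dots> = (t - s)\<^sup>2 / (real N * y\<^sup>2)"
        using N by (simp add: h_def power2_eq_square)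
      also have "\<dots> \<le> \<epsilon>"
        using N \<epsilon> y by (simp add: field_simps)
      finally show ?thesis .
    qed
    moreover have "converges ?R"
      by (intro converges_sum converges_cmult converges_poisson y) auto
    ultimately show "\<exists>h'. converges h' \<and>
        (\<forall>x. \<bar>arctan ((t - x) / y) - arctan ((s - x) / y) - h' x\<bar> \<le> \<epsilon>)"
      by blast
  qed measurable
  consider "s < t" | "s = t" | "t < s" by linarith
  then show ?thesis
  proof cases
    case 2 then show ?thesis using converges_const[of 0] by simp
  next
    case 3 then show ?thesis using converges_cmult[OF main[OF 3], of "-1"] by simp
  qed (rule main)
qed

text \<open>The difference of arctangents over a slightly longer interval, lifted by a small constant, lies above
the indicator; over a slightly shorter one, lowered by this constant, it lies below. With kernel width
\<open>1/c\<^sup>2\<close> and a displacement \<open>1/c\<close> of the endpoints, the displacement is large compared with the width, so both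
tend to the indicator as \<open>c\<close> grows, except at the endpoints, which are null sets.\<close>

lemma converges_indicator:
  assumes st: "s < t" and null: "measure \<mu> {s} = 0" "measure \<mu> {t} = 0"
  shows "converges (indicator {s<..t})"
proof (rule converges_sandwich)
  define c :: "nat \<Rightarrow> real" where "c j = real (Suc j)" for j
  have c: "c j > 0" for j by (simp add: c_def)
  \<comment> \<open>\<open>A r \<sigma> j\<close> is the smoothed jump at \<open>r + \<sigma> / c j\<close>; see \<open>A_eq\<close>.\<close>
  define A where "A r \<sigma> j x = arctan ((r - x) * (c j)\<^sup>2 + \<sigma> * c j)" for r \<sigma> :: real and j x
  \<comment> \<open>A bound for the deviation from the indicator at distance at least \<open>1 / c j\<close> from the displaced endpoints.\<close>
  define \<theta> where "\<theta> j = 1 - 2 * arctan (c j) / pi" for j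
  define u where "u j x = (A t 1 j x - A s (-1) j x) / pi + \<theta> j" for j x
  define l where "l j x = (A t (-1) j x - A s 1 j x) / pi - \<theta> j" for j x
  have A_bound: "- (pi / 2) < A r \<sigma> j x" "A r \<sigma> j x < pi / 2" for r \<sigma> j x
    using arctan_bounded by (auto simp: A_def)
  have A_eq: "A r \<sigma> j x = arctan ((r + \<sigma> / c j - x) / (1 / (c j)\<^sup>2))" for r \<sigma> j x
  proof -
    have "(r - x) * (c j)\<^sup>2 + \<sigma> * c j = (r + \<sigma> / c j - x) / (1 / (c j)\<^sup>2)"
      using c[of j] by (simp add: field_simps power2_eq_square)
    then show ?thesis by (simp add: A_def)
  qed
  have A_meas [measurable]: "A r \<sigma> j \<in> borel_measurable borel" for r \<sigma> j
    unfolding A_def by measurable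
  have conv_A: "converges (\<lambda>x. A r \<sigma> j x - A q \<tau> j x)" for r \<sigma> q \<tau> j
    unfolding A_eq using c[of j] by (intro converges_arctan_diff) simp
  have conv: "converges (u j)" "converges (l j)" for j
    unfolding u_def l_def using converges_cmult[OF conv_A, of "1 / pi"]
    by (auto intro!: converges_add converges_diff converges_const)
  have \<theta>: "(\<theta> \<longlongrightarrow> 0) sequentially"
  proof -
    have c_inf: "filterlim c at_top sequentially"
      unfolding c_def[abs_def] by real_asymp
    have "(\<lambda>j. arctan (c j)) \<longlonglongrightarrow> pi / 2"
      using tendsto_arctan_at_top c_inf by (rule filterlim_compose)
    then have "(\<lambda>j. 1 - 2 * arctan (c j) / pi) \<longlonglongrightarrow> 1 - 2 * (pi / 2) / pi"
      by (intro tendsto_intros) auto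
    then show ?thesis by (simp add: \<theta>_def[abs_def])
  qed
  have A_up: "arctan (c j) \<le> A r 1 j x" if "x \<le> r" for r j x
    unfolding A_def using that by (intro arctan_monotone') auto
  have A_down: "A r (-1) j x \<le> - arctan (c j)" if "r \<le> x" for r j x
    unfolding A_def arctan_minus[symmetric] using that
    by (intro arctan_monotone') (auto simp: mult_nonpos_nonneg)
  have arctan_c: "arctan (c j) > 0" "arctan (c j) < pi / 2" for j
    using c[of j] arctan_ubound by auto
  have upper: "indicator {s<..t} x \<le> u j x" for j x
  proof (cases "x \<in> {s<..t}")
    case True
    then have "2 * arctan (c j) \<le> A t 1 j x - A s (-1) j x"
      using A_up[of x t j] A_down[of s x j] by auto
    then have "2 * arctan (c j) / pi \<le> (A t 1 j x - A s (-1) j x) / pi"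
      by (intro divide_right_mono) auto
    with True show ?thesis by (simp add: u_def \<theta>_def)
  next
    case False
    have "(s - x) * (c j)\<^sup>2 + (-1) * c j \<le> (t - x) * (c j)\<^sup>2 + 1 * c j"
      using st c[of j] by (intro add_mono mult_right_mono) auto
    then have "A s (-1) j x \<le> A t 1 j x"
      unfolding A_def by (rule arctan_monotone')
    then have "0 \<le> (A t 1 j x - A s (-1) j x) / pi"
      by simp
    moreover have "0 \<le> \<theta> j"
      using arctan_c[of j] by (simp add: \<theta>_def field_simps)
    ultimately show ?thesis
      using False by (simp add: u_def)
  qed
  have lower: "l j x \<le> indicator {s<..t} x" for j x
  proof -
    have "A t (-1) j x - A s 1 j x \<le> pi * indicator {s<..t} x + (pi - 2 * arctan (c j))"
      using A_up[of x s j] A_down[of t x j] A_bound[of t "-1" j x] A_bound[of s 1 j x] arctan_c[of j]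
      by (auto simp: indicator_def)
    from divide_right_mono[OF this, of pi] show ?thesis
      by (simp add: l_def \<theta>_def add_divide_distrib diff_divide_distrib)
  qed
  have A_diff: "(\<lambda>j. A r 1 j x - A r (-1) j x) \<longlonglongrightarrow> 0" if "x \<noteq> r" for r x
  proof -
    have lim: "(\<lambda>j. A r \<sigma> j x) \<longlonglongrightarrow> (if x < r then pi / 2 else - (pi / 2))" for \<sigma>
    proof (cases "x < r")
      case True
      have "filterlim (\<lambda>j. d * (real (Suc j))\<^sup>2 + \<sigma> * real (Suc j)) at_top sequentially" if "d > 0" for d
        using that by real_asymp
      then have "filterlim (\<lambda>j. (r - x) * (c j)\<^sup>2 + \<sigma> * c j) at_top sequentially"
        using True unfolding c_def by simp
      from filterlim_compose[OF tendsto_arctan_at_top this] True show ?thesis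
        unfolding A_def by simp
    next
      case False
      have "filterlim (\<lambda>j. d * (real (Suc j))\<^sup>2 + \<sigma> * real (Suc j)) at_bot sequentially" if "d < 0" for d
        using that by real_asymp
      then have "filterlim (\<lambda>j. (r - x) * (c j)\<^sup>2 + \<sigma> * c j) at_bot sequentially"
        using False \<open>x \<noteq> r\<close> unfolding c_def by simp
      from filterlim_compose[OF tendsto_arctan_at_bot this] False show ?thesis
        unfolding A_def by simp
    qed
    show ?thesis using tendsto_diff[OF lim[of 1] lim[of "-1"]] by simp
  qed
  have "(\<lambda>j. LINT x|\<mu>. u j x - l j x) \<longlonglongrightarrow> (LINT x|\<mu>. 0)"
  proof (rule integral_dominated_convergence[where w="\<lambda>_. 4"])
    show "(\<lambda>x. u j x - l j x) \<in> borel_measurable \<mu>" for j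
      unfolding u_def l_def by measurable
    have "AE x in \<mu>. x \<noteq> s" "AE x in \<mu>. x \<noteq> t"
      using null by (auto simp: AE_iff_measurable[OF _ refl] emeasure_eq_measure)
    then show "AE x in \<mu>. (\<lambda>j. u j x - l j x) \<longlonglongrightarrow> 0"
    proof eventually_elim
      case (elim x)
      have "u j x - l j x = ((A t 1 j x - A t (-1) j x) + (A s 1 j x - A s (-1) j x)) / pi + 2 * \<theta> j" for j
        by (simp add: u_def l_def field_simps)
      moreover have "(\<lambda>j. ((A t 1 j x - A t (-1) j x) + (A s 1 j x - A s (-1) j x)) / pi + 2 * \<theta> j)
          \<longlonglongrightarrow> (0 + 0) / pi + 2 * 0"
        using elim by (intro tendsto_intros A_diff \<theta>) auto
      ultimately show ?case by simp
    qed
    show "AE x in \<mu>. norm (u j x - l j x) \<le> 4" for j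
    proof (rule AE_I2)
      fix x
      have "\<bar>A t 1 j x - A t (-1) j x + (A s 1 j x - A s (-1) j x)\<bar> \<le> 2 * pi"
        using A_bound[of t "-1" j x] A_bound[of s 1 j x] A_bound[of t 1 j x] A_bound[of s "-1" j x]
        by linarith
      then have "\<bar>(A t 1 j x - A t (-1) j x + (A s 1 j x - A s (-1) j x)) / pi\<bar> \<le> 2"
        by (simp add: field_simps)
      moreover have "u j x - l j x = (A t 1 j x - A t (-1) j x + (A s 1 j x - A s (-1) j x)) / pi + 2 * \<theta> j"
        by (simp add: u_def l_def field_simps)
      moreover have "0 \<le> \<theta> j" "\<theta> j \<le> 1"
        using arctan_c[of j] by (auto simp: \<theta>_def field_simps)
      ultimately show "norm (u j x - l j x) \<le> 4"
        unfolding real_norm_def by linarith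
    qed
  qed auto
  then have lim: "(\<lambda>j. (LINT x|\<mu>. u j x) - (LINT x|\<mu>. l j x)) \<longlonglongrightarrow> 0"
    using conv by (simp add: converges_def)
  fix \<epsilon> :: real assume "\<epsilon> > 0"
  from order_tendstoD(2)[OF lim this] obtain j where "(LINT x|\<mu>. u j x) - (LINT x|\<mu>. l j x) < \<epsilon>"
    by (auto simp: eventually_sequentially)
  then show "\<exists>l u. converges l \<and> converges u \<and>
      (\<forall>x. l x \<le> indicator {s<..t} x \<and> indicator {s<..t} x \<le> u x) \<and>
      (LINT x|\<mu>. u x) - (LINT x|\<mu>. l x) < \<epsilon>"
    using conv upper lower by blast
qed measurable

end

section \<open>Riemann--Stieltjes integrands between convergent step functions\<close>

text \<open>Replaces the suprema in Darboux sums by values that the function attains, as required for the tags of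
Riemann sums.\<close>

lemma near_maximum:
  fixes f :: "'a \<Rightarrow> real"
  assumes "S \<noteq> {}" "bdd_above (f ` S)" "e > 0"
  shows "\<exists>\<xi>\<in>S. \<forall>x\<in>S. f x \<le> f \<xi> + e"
proof -
  obtain \<xi> where \<xi>: "\<xi> \<in> S" "Sup (f ` S) - e < f \<xi>"
    using less_cSupD[of "f ` S" "Sup (f ` S) - e"] assms by auto
  moreover have "f x \<le> Sup (f ` S)" if "x \<in> S" for x
    using that assms by (intro cSup_upper) auto
  ultimately show ?thesis
    by (intro bexI[of _ \<xi>]) force+
qed

lemma (in finite_borel_measure) fine_partition_avoiding_atoms:
  assumes ab: "a < b" and \<delta>: "\<delta> > 0" and null: "measure M {a} = 0" "measure M {b} = 0"
  shows "\<exists>(n :: nat) t. t 0 = a \<and> t n = b \<and> (\<forall>k<n. t k < t (Suc k) \<and> t (Suc k) - t k < \<delta>) \<and>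
    (\<forall>k\<le>n. measure M {t k} = 0)"
proof -
  obtain N :: nat where "max 1 (2 * (b - a) / \<delta>) < real N"
    using reals_Archimedean2 by blast
  then have N: "N > 0" "2 * (b - a) / \<delta> < real N"
    by auto
  define h where "h = (b - a) / N"
  have h: "h > 0" "2 * h < \<delta>" and Nh: "a + real N * h = b"
    using ab N \<delta> by (auto simp: h_def field_simps)
  \<comment> \<open>Moving each point of a uniform grid by less than half a step keeps all steps below \<open>3/2 * h\<close>.\<close>
  have "\<exists>x\<in>{a + real k * h<..<a + real k * h + h / 2}. x \<notin> {x. measure M {x} > 0}" for k
    using h(1) countable_atoms by (intro real_interval_avoid_countable_set) auto
  then have "\<exists>x. a + real k * h < x \<and> x < a + real k * h + h / 2 \<and> measure M {x} = 0" for k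
    by (fastforce simp: zero_less_measure_iff)
  then obtain c where c: "\<And>k. a + real k * h < c k" "\<And>k. c k < a + real k * h + h / 2"
    "\<And>k. measure M {c k} = 0"
    by metis
  define t where "t k = (if k = 0 then a else if k = N then b else c k)" for k
  have loc: "a + real k * h \<le> t k" "t k < a + real k * h + h / 2" if "k \<le> N" for k
    using c(1)[of k] c(2)[of k] h Nh by (auto simp: t_def)
  show ?thesis
  proof (intro exI conjI allI impI)
    show "t 0 = a" "t N = b" using N by (auto simp: t_def)
    fix k assume "k < N"
    moreover have "a + real (Suc k) * h = a + real k * h + h" by (simp add: algebra_simps)
    ultimately show "t k < t (Suc k)" "t (Suc k) - t k < \<delta>"
      using loc[of k] loc[of "Suc k"] h by auto
  next
    fix k assume "k \<le> N" then show "measure M {t k} = 0"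
      using c null by (auto simp: t_def)
  qed
qed

text \<open>The conjunct \<open>t 0 \<le> t n\<close> is carried along for the induction: it makes the half-open intervals tile
\<open>{t 0<..t n}\<close>.\<close>

lemma step_function_le:
  fixes t :: "nat \<Rightarrow> real" and f :: "real \<Rightarrow> real"
  assumes "\<And>k. k < n \<Longrightarrow> t k \<le> t (Suc k)"
    and "\<And>k x. k < n \<Longrightarrow> x \<in> {t k<..t (Suc k)} \<Longrightarrow> v k \<le> f x"
  shows "(\<Sum>k<n. v k * indicator {t k<..t (Suc k)} x) \<le> f x * indicator {t 0<..t n} x \<and> t 0 \<le> t n"
  using assms
proof (induction n)
  case (Suc n)
  have le: "t n \<le> t (Suc n)" using Suc.prems(1) by simp
  have "(\<Sum>k<n. v k * indicator {t k<..t (Suc k)} x) \<le> f x * indicator {t 0<..t n} x \<and> t 0 \<le> t n"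
    using Suc.prems by (intro Suc.IH) auto
  moreover have "v n * indicator {t n<..t (Suc n)} x \<le> f x * indicator {t n<..t (Suc n)} x"
    using Suc.prems(2)[of n x] by (auto simp: indicator_def)
  moreover have "f x * indicator {t 0<..t (Suc n)} x =
      f x * indicator {t 0<..t n} x + f x * indicator {t n<..t (Suc n)} x" if "t 0 \<le> t n"
    using le that by (auto simp: indicator_def)
  ultimately show ?case using le by auto
qed simp

text \<open>The exponent \<open>2m + 2\<close> is even, so the right-hand side is a polynomial, and it exceeds \<open>m\<close>, which leaves
room for the factor \<open>1/R\<close>.\<close>

lemma power_tail_bound:
  fixes x :: real
  assumes R: "1 \<le> R" "R \<le> \<bar>x\<bar>" and "0 < a" "0 < b"
  shows "a + b * \<bar>x\<bar> ^ m \<le> (a + b) / R * x ^ (2 * m + 2)"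
proof -
  have x1: "1 \<le> \<bar>x\<bar>" using R by simp
  then have one: "1 \<le> \<bar>x\<bar> ^ m" by simp
  have "\<bar>x\<bar> ^ m * R \<le> \<bar>x\<bar> ^ m * \<bar>x\<bar>"
    using R by (intro mult_left_mono) auto
  also have "\<dots> = \<bar>x\<bar> ^ (m + 1)" by simp
  also have "\<dots> \<le> \<bar>x\<bar> ^ (2 * m + 2)"
    using x1 by (intro power_increasing) auto
  also have "\<dots> = x ^ (2 * m + 2)" by (rule power_even_abs) simp
  finally have "\<bar>x\<bar> ^ m \<le> x ^ (2 * m + 2) / R"
    using R by (simp add: field_simps)
  then have "(a + b) * \<bar>x\<bar> ^ m \<le> (a + b) * (x ^ (2 * m + 2) / R)"
    using assms by (intro mult_left_mono) auto
  moreover have "a + b * \<bar>x\<bar> ^ m \<le> (a + b) * \<bar>x\<bar> ^ m"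
    using one \<open>0 < a\<close> by (simp add: distrib_right)
  ultimately show ?thesis by simp
qed

context poisson_quadrature
begin

text \<open>Two choices of tags on one fine partition, nearly maximal and nearly minimal on each piece, give
Riemann--Stieltjes sums close to the same number. These sums are the integrals of step functions above and
below \<open>f\<close>. The partition points are taken outside of the countable set of atoms, where indicators of
intervals converge.\<close>

lemma rs_integrable_step_sandwich:
  assumes \<epsilon>: "\<epsilon> > 0" and ab: "a < b" and null: "measure \<mu> {a} = 0" "measure \<mu> {b} = 0"
    and rs: "rs_integrable f (cdf \<mu>) a b"
    and bound: "\<And>x. x \<in> {a..b} \<Longrightarrow> \<bar>f x\<bar> \<le> B"
  shows "\<exists>l u. converges l \<and> converges u \<and>
    (\<forall>x. l x \<le> f x * indicator {a<..b} x \<and> f x * indicator {a<..b} x \<le> u x) \<and>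
    (LINT x|\<mu>. u x) - (LINT x|\<mu>. l x) < \<epsilon>"
proof -
  define e where "e = \<epsilon> / 4"
  have e: "e > 0" using \<epsilon> by (simp add: e_def)
  obtain I where rsI: "\<forall>\<epsilon>>0. \<exists>\<delta>>0. \<forall>n t \<xi>. t 0 = a \<and> t n = b \<and>
      (\<forall>k<n. t k < t (Suc k) \<and> t (Suc k) - t k < \<delta> \<and> \<xi> k \<in> {t k..t (Suc k)}) \<longrightarrow>
      \<bar>(\<Sum>k<n. f (\<xi> k) * (cdf \<mu> (t (Suc k)) - cdf \<mu> (t k))) - I\<bar> < \<epsilon>"
    using rs unfolding rs_integrable_def by (elim exE)
  obtain \<delta> where \<delta>: "\<delta> > 0" and rs\<delta>: "\<forall>n t \<xi>. t 0 = a \<and> t n = b \<and>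
      (\<forall>k<n. t k < t (Suc k) \<and> t (Suc k) - t k < \<delta> \<and> \<xi> k \<in> {t k..t (Suc k)}) \<longrightarrow>
      \<bar>(\<Sum>k<n. f (\<xi> k) * (cdf \<mu> (t (Suc k)) - cdf \<mu> (t k))) - I\<bar> < e"
    using rsI[THEN spec, THEN mp, OF e] by (elim exE conjE)
  have I: "\<bar>(\<Sum>k<n. f (\<zeta> k) * (cdf \<mu> (t (Suc k)) - cdf \<mu> (t k))) - I\<bar> < e"
    if "t 0 = a" "t n = b"
      "\<And>k. k < n \<Longrightarrow> t k < t (Suc k) \<and> t (Suc k) - t k < \<delta> \<and> \<zeta> k \<in> {t k..t (Suc k)}" for n t \<zeta>
    by (rule rs\<delta>[THEN spec[of _ n], THEN spec[of _ t], THEN spec[of _ \<zeta>], THEN mp])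
      (intro conjI allI impI; fact?; use that in blast)
  obtain n t where partition: "t 0 = a \<and> t n = b \<and> (\<forall>k<n. t k < t (Suc k) \<and> t (Suc k) - t k < \<delta>) \<and>
      (\<forall>k\<le>n. measure \<mu> {t k} = 0)"
    using fine_partition_avoiding_atoms[OF ab \<delta> null] by (elim exE)
  then have t: "t 0 = a" "t n = b" "\<And>k. k < n \<Longrightarrow> t k < t (Suc k) \<and> t (Suc k) - t k < \<delta>"
    and t_null: "\<And>k. k \<le> n \<Longrightarrow> measure \<mu> {t k} = 0"
    by simp_all
  have mono_t: "t i \<le> t j" if "i \<le> j" "j \<le> n" for i j
    using that
  proof (induction j)
    case (Suc j)
    then show ?case using t(3)[of j] by (cases "i = Suc j") auto
  qed simp
  have sub: "{t k..t (Suc k)} \<subseteq> {a..b}" if "k < n" for k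
    using mono_t[of 0 k] mono_t[of "Suc k" n] that t(1,2) by auto
  have ne: "{t k..t (Suc k)} \<noteq> {}" if "k < n" for k
    using t(3)[OF that] by auto
  have bdd: "f x \<le> B" "- f x \<le> B" if "k < n" "x \<in> {t k..t (Suc k)}" for k x
    using bound[of x] sub[OF that(1)] that(2) by (auto simp: abs_le_iff)
  have "\<forall>k\<in>{..<n}. \<exists>\<xi>. \<xi> \<in> {t k..t (Suc k)} \<and> (\<forall>x\<in>{t k..t (Suc k)}. f x \<le> f \<xi> + e)"
  proof
    fix k assume "k \<in> {..<n}"
    then have k: "k < n" by simp
    have "bdd_above (f ` {t k..t (Suc k)})"
      using bdd(1)[OF k] by (rule bdd_aboveI2)
    from near_maximum[OF ne[OF k] this e]
    show "\<exists>\<xi>. \<xi> \<in> {t k..t (Suc k)} \<and> (\<forall>x\<in>{t k..t (Suc k)}. f x \<le> f \<xi> + e)"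
      by (simp only: Bex_def)
  qed
  then obtain \<xi> where "\<forall>k\<in>{..<n}. \<xi> k \<in> {t k..t (Suc k)} \<and> (\<forall>x\<in>{t k..t (Suc k)}. f x \<le> f (\<xi> k) + e)"
    by (rule bchoice[THEN exE])
  then have \<xi>: "\<And>k. k < n \<Longrightarrow> \<xi> k \<in> {t k..t (Suc k)}"
    "\<And>k x. k < n \<Longrightarrow> x \<in> {t k..t (Suc k)} \<Longrightarrow> f x \<le> f (\<xi> k) + e"
    by (simp_all only: lessThan_iff Ball_def)
  have "\<forall>k\<in>{..<n}. \<exists>\<eta>. \<eta> \<in> {t k..t (Suc k)} \<and> (\<forall>x\<in>{t k..t (Suc k)}. - f x \<le> - f \<eta> + e)"
  proof
    fix k assume "k \<in> {..<n}"
    then have k: "k < n" by simp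
    have "bdd_above ((\<lambda>x. - f x) ` {t k..t (Suc k)})"
      using bdd(2)[OF k] by (rule bdd_aboveI2)
    from near_maximum[OF ne[OF k] this e]
    show "\<exists>\<eta>. \<eta> \<in> {t k..t (Suc k)} \<and> (\<forall>x\<in>{t k..t (Suc k)}. - f x \<le> - f \<eta> + e)"
      by (simp only: Bex_def)
  qed
  then obtain \<eta> where "\<forall>k\<in>{..<n}. \<eta> k \<in> {t k..t (Suc k)} \<and> (\<forall>x\<in>{t k..t (Suc k)}. - f x \<le> - f (\<eta> k) + e)"
    by (rule bchoice[THEN exE])
  then have \<eta>: "\<And>k. k < n \<Longrightarrow> \<eta> k \<in> {t k..t (Suc k)}"
    "\<And>k x. k < n \<Longrightarrow> x \<in> {t k..t (Suc k)} \<Longrightarrow> - f x \<le> - f (\<eta> k) + e"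
    by (simp_all only: lessThan_iff Ball_def)
  have \<eta>': "f (\<eta> k) - e \<le> f x" if "k < n" "x \<in> {t k..t (Suc k)}" for k x
    using \<eta>(2)[OF that] by simp
  define step where "step v x = (\<Sum>k<n. v k * indicator {t k<..t (Suc k)} x)" for v :: "nat \<Rightarrow> real" and x
  have conv_ind: "converges (indicator {t k<..t (Suc k)})" if "k < n" for k
    using that t(3)[OF that] t_null by (intro converges_indicator) auto
  have conv: "converges (step v)" for v
    unfolding step_def using conv_ind by (intro converges_sum converges_cmult) auto
  have int_step: "(LINT x|\<mu>. step v x) = (\<Sum>k<n. v k * (cdf \<mu> (t (Suc k)) - cdf \<mu> (t k)))" for v
  proof -
    have "(LINT x|\<mu>. step v x) = (\<Sum>k<n. v k * (LINT x|\<mu>. indicator {t k<..t (Suc k)} x))"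
      unfolding step_def using conv_ind by (subst Bochner_Integration.integral_sum) (auto simp: converges_def)
    also have "\<dots> = (\<Sum>k<n. v k * (cdf \<mu> (t (Suc k)) - cdf \<mu> (t k)))"
      using t(3) by (intro sum.cong refl) (simp add: cdf_diff_eq)
    finally show ?thesis .
  qed
  have t_le: "\<And>k. k < n \<Longrightarrow> t k \<le> t (Suc k)" using t(3) less_imp_le by blast
  have lower: "step (\<lambda>k. f (\<eta> k) - e) x \<le> f x * indicator {a<..b} x" for x
    using step_function_le[of n t "\<lambda>k. f (\<eta> k) - e" f x] t_le \<eta>' unfolding step_def t(1,2) by auto
  have upper: "f x * indicator {a<..b} x \<le> step (\<lambda>k. f (\<xi> k) + e) x" for x
  proof -
    have "- (f (\<xi> k) + e) \<le> - f x" if "k < n" "x \<in> {t k<..t (Suc k)}" for k x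
      using \<xi>(2)[of k x] that by simp
    from step_function_le[of n t "\<lambda>k. - (f (\<xi> k) + e)" "\<lambda>x. - f x" x, OF t_le this]
    have "(\<Sum>k<n. - (f (\<xi> k) + e) * indicator {t k<..t (Suc k)} x) \<le> - f x * indicator {a<..b} x"
      unfolding t(1,2) by blast
    then show ?thesis
      unfolding step_def mult_minus_left sum_negf by linarith
  qed
  have mass: "(\<Sum>k<n. cdf \<mu> (t (Suc k)) - cdf \<mu> (t k)) \<le> 1"
    using cdf_bounded_prob[of "t n"] cdf_nonneg[of "t 0"] sum_lessThan_telescope[of "\<lambda>k. cdf \<mu> (t k)" n]
    by linarith
  have "\<bar>(\<Sum>k<n. f (\<xi> k) * (cdf \<mu> (t (Suc k)) - cdf \<mu> (t k))) - I\<bar> < e"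
    "\<bar>(\<Sum>k<n. f (\<eta> k) * (cdf \<mu> (t (Suc k)) - cdf \<mu> (t k))) - I\<bar> < e"
    using t(3) \<xi>(1) \<eta>(1) by (intro I t(1,2); simp)+
  moreover have "e * (\<Sum>k<n. cdf \<mu> (t (Suc k)) - cdf \<mu> (t k)) \<le> e"
    using mass e by (simp add: mult_left_le)
  moreover have "(LINT x|\<mu>. step (\<lambda>k. f (\<xi> k) + e) x) =
      (\<Sum>k<n. f (\<xi> k) * (cdf \<mu> (t (Suc k)) - cdf \<mu> (t k))) + e * (\<Sum>k<n. cdf \<mu> (t (Suc k)) - cdf \<mu> (t k))"
    "(LINT x|\<mu>. step (\<lambda>k. f (\<eta> k) - e) x) =
      (\<Sum>k<n. f (\<eta> k) * (cdf \<mu> (t (Suc k)) - cdf \<mu> (t k))) - e * (\<Sum>k<n. cdf \<mu> (t (Suc k)) - cdf \<mu> (t k))"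
    by (simp_all add: int_step distrib_right left_diff_distrib right_diff_distrib sum.distrib
        sum_subtractf sum_distrib_left)
  ultimately have "(LINT x|\<mu>. step (\<lambda>k. f (\<xi> k) + e) x) - (LINT x|\<mu>. step (\<lambda>k. f (\<eta> k) - e) x) < 4 * e"
    by linarith
  then show ?thesis
    using conv lower upper by (intro exI[of _ "step (\<lambda>k. f (\<eta> k) - e)"] exI[of _ "step (\<lambda>k. f (\<xi> k) + e)"])
      (auto simp: e_def)
qed

theorem polynomially_bounded_sandwich:
  assumes \<epsilon>: "\<epsilon> > 0" and ab: "0 < a" "0 < b"
    and bound: "\<And>x. \<bar>f x\<bar> \<le> a + b * \<bar>x\<bar> ^ m"
    and moment: "converges (\<lambda>x. x ^ (2 * m + 2))"
    and rs: "\<And>R. R > 0 \<Longrightarrow> measure \<mu> {-R} = 0 \<Longrightarrow> measure \<mu> {R} = 0 \<Longrightarrow> rs_integrable f (cdf \<mu>) (-R) R"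
  shows "\<exists>l u. converges l \<and> converges u \<and> (\<forall>x. l x \<le> f x \<and> f x \<le> u x) \<and>
    (LINT x|\<mu>. u x) - (LINT x|\<mu>. l x) < \<epsilon>"
proof -
  define C where "C = (LINT x|\<mu>. x ^ (2 * m + 2))"
  \<comment> \<open>The tail bound contributes twice \<open>(a + b) * C / R\<close> to the gap, so this \<open>R0\<close> keeps it below half of \<open>\<epsilon>\<close>.\<close>
  define R0 where "R0 = max 1 (4 * (a + b) * C / \<epsilon>)"
  define A where "A = {x. measure \<mu> {x} > 0} \<union> uminus ` {x. measure \<mu> {x} > 0}"
  have "countable A"
    using countable_atoms by (auto simp: A_def)
  then obtain R where "R \<in> {R0<..<R0 + 1}" and "R \<notin> A"
    using real_interval_avoid_countable_set[of R0 "R0 + 1" A] by auto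
  then have "R0 < R" "\<not> measure \<mu> {R} > 0" "\<not> measure \<mu> {-R} > 0"
    by (auto simp: A_def image_iff dest: spec[of _ "-R"])
  then have R: "R0 < R" and null: "measure \<mu> {R} = 0" "measure \<mu> {-R} = 0"
    using measure_nonneg[of \<mu> "{R}"] measure_nonneg[of \<mu> "{-R}"] by linarith+
  have R1: "1 \<le> R" and RC: "4 * (a + b) * C / \<epsilon> < R" using R by (auto simp: R0_def)
  have tail_small: "2 * ((a + b) / R * C) < \<epsilon> / 2"
    using RC R1 \<epsilon> by (simp add: field_simps)
  obtain l u where lu: "converges l" "converges u"
    "\<And>x. l x \<le> f x * indicator {-R<..R} x" "\<And>x. f x * indicator {-R<..R} x \<le> u x"
    "(LINT x|\<mu>. u x) - (LINT x|\<mu>. l x) < \<epsilon> / 2"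
  proof -
    have "\<bar>f x\<bar> \<le> a + b * R ^ m" if "x \<in> {-R..R}" for x
    proof -
      have "\<bar>x\<bar> ^ m \<le> R ^ m"
        using that by (intro power_mono) auto
      from mult_left_mono[OF this, of b] show ?thesis
        using bound[of x] ab by linarith
    qed
    then show ?thesis
      using rs_integrable_step_sandwich[of "\<epsilon> / 2" "-R" R f "a + b * R ^ m"] \<epsilon> R1 null rs[of R] that
      by auto
  qed
  define tail where "tail x = (a + b) / R * x ^ (2 * m + 2)" for x :: real
  have conv_tail: "converges tail"
    unfolding tail_def by (intro converges_cmult moment)
  have tail_nonneg: "0 \<le> tail x" for x
    unfolding tail_def using ab R1 by (intro mult_nonneg_nonneg zero_le_even_power) auto
  have tail: "\<bar>f x\<bar> \<le> tail x" if "x \<notin> {-R<..R}" for x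
  proof -
    have "R \<le> \<bar>x\<bar>" using that by auto
    from order_trans[OF bound power_tail_bound[OF R1 this ab]] show ?thesis
      unfolding tail_def .
  qed
  show ?thesis
  proof (intro exI conjI allI)
    show "converges (\<lambda>x. l x - tail x)" "converges (\<lambda>x. u x + tail x)"
      using lu conv_tail by (auto intro: converges_add converges_diff)
    show "l x - tail x \<le> f x" "f x \<le> u x + tail x" for x
      using lu(3,4)[of x] tail[of x] tail_nonneg[of x] by (cases "x \<in> {-R<..R}"; force)+
    have "(LINT x|\<mu>. tail x) = (a + b) / R * C"
      unfolding tail_def C_def by simp
    moreover have "(LINT x|\<mu>. u x + tail x) - (LINT x|\<mu>. l x - tail x) =
        ((LINT x|\<mu>. u x) - (LINT x|\<mu>. l x)) + 2 * (LINT x|\<mu>. tail x)"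
      using lu(1,2) conv_tail by (simp add: converges_def)
    ultimately show "(LINT x|\<mu>. u x + tail x) - (LINT x|\<mu>. l x - tail x) < \<epsilon>"
      using lu(5) tail_small by linarith
  qed
qed

end

section \<open>Truncations of the matrix of a multiplication operator\<close>

text \<open>The assumption \<open>invariant\<close> stands for polynomials: multiplication by a polynomial \<open>g\<close> maps each of the
orthonormal polynomials to a finite combination of them.\<close>

locale multiplication_matrix = prob_space M for M :: "'a measure" +
  fixes \<phi> :: "nat \<Rightarrow> 'a \<Rightarrow> complex" and g :: "'a \<Rightarrow> real"
  assumes g [measurable]: "g \<in> borel_measurable M"
    and orth: "l2_orthonormal M \<phi>"
    and phi_0: "\<phi> 0 = (\<lambda>_. 1)"
    and invariant: "(\<lambda>x. complex_of_real (g x) * \<phi> i x) \<in> fun_span \<phi>"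
begin

abbreviation entry :: "nat \<Rightarrow> nat \<Rightarrow> complex" where
  "entry \<equiv> mult_entry M \<phi> g"

lemma phi_L2: "\<phi> i \<in> L2 M"
  using orth by (simp add: l2_orthonormal_def)

lemma phi_inner: "l2_inner M (\<phi> i) (\<phi> j) = (if i = j then 1 else 0)"
  using orth by (simp add: l2_orthonormal_def)

lemma fun_span_L2: "F \<in> fun_span \<phi> \<Longrightarrow> F \<in> L2 M"
  by (auto simp: fun_span_def intro!: L2_sum L2_cmult phi_L2)

lemma fun_span_expansion:
  assumes "F \<in> fun_span \<phi>"
  shows "\<exists>N. (\<forall>n\<ge>N. \<forall>x. F x = (\<Sum>l\<le>n. l2_inner M (\<phi> l) F * \<phi> l x)) \<and> (\<forall>l>N. l2_inner M (\<phi> l) F = 0)"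
proof -
  obtain N c where F: "F = (\<lambda>x. \<Sum>l\<le>N. c l * \<phi> l x)"
    using assms by (auto simp: fun_span_def)
  have coeff: "l2_inner M (\<phi> j) F = (if j \<le> N then c j else 0)" for j
  proof -
    have "l2_inner M (\<phi> j) F = (\<Sum>l\<le>N. c l * l2_inner M (\<phi> j) (\<phi> l))"
      unfolding F by (rule l2_inner_sum_right) (auto intro: phi_L2)
    also have "\<dots> = (\<Sum>l\<le>N. if j = l then c l else 0)"
      by (intro sum.cong) (auto simp: phi_inner)
    finally show ?thesis by simp
  qed
  have "F x = (\<Sum>l\<le>n. l2_inner M (\<phi> l) F * \<phi> l x)" if "N \<le> n" for n x
    unfolding coeff using that unfolding F by (intro sum.mono_neutral_cong_left) auto
  then show ?thesis using coeff by (intro exI[of _ N]) auto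
qed

lemma entry_hermitian: "entry i j = cnj (entry j i)"
  unfolding mult_entry_def l2_inner_def Bochner_Integration.integral_cnj[symmetric]
  by (intro Bochner_Integration.integral_cong) (auto simp: mult_ac)

lemma inner_mult_g: "l2_inner M (\<lambda>x. complex_of_real (g x) * \<psi> x) \<theta> = l2_inner M \<psi> (\<lambda>x. complex_of_real (g x) * \<theta> x)"
  by (simp add: l2_inner_def mult_ac)

text \<open>Beyond this index the entries of row \<open>i\<close> vanish, so all row sums are finite sums.\<close>

definition row_bound :: "nat \<Rightarrow> nat" where
  "row_bound i = (SOME N. \<forall>l>N. entry i l = 0)"

lemma entry_column: "\<exists>N. (\<forall>n\<ge>N. \<forall>x. complex_of_real (g x) * \<phi> i x = (\<Sum>l\<le>n. entry l i * \<phi> l x)) \<and> (\<forall>l>N. entry l i = 0)"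
  using fun_span_expansion[OF invariant[of i]] by (simp add: mult_entry_def)

lemma entry_row_finite: "row_bound i < l \<Longrightarrow> entry i l = 0"
proof -
  have "\<exists>N. \<forall>l>N. entry i l = 0"
    using entry_column[of i] entry_hermitian[of i] by (metis complex_cnj_zero)
  from someI_ex[OF this] show "row_bound i < l \<Longrightarrow> entry i l = 0"
    unfolding row_bound_def by blast
qed

lemma row_sum_truncate:
  assumes "row_bound i \<le> n"
  shows "(\<Sum>l\<le>n. entry i l * v l) = (\<Sum>l\<le>row_bound i. entry i l * v l)"
  using assms by (intro sum.mono_neutral_right) (auto simp: entry_row_finite)

lemma suminf_row: "suminf (\<lambda>l. entry i l * v l) = (\<Sum>l\<le>row_bound i. entry i l * v l)"
  by (intro suminf_finite) (auto simp: entry_row_finite)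

text \<open>Row \<open>i\<close> applied to the coefficients of an arbitrary square integrable \<open>\<psi>\<close>; it holds even if \<open>g \<psi>\<close> is not
square integrable, since \<open>g\<close> acts on \<open>\<phi> i\<close>.\<close>

lemma inner_row:
  assumes \<psi>: "\<psi> \<in> L2 M"
  shows "l2_inner M (\<lambda>x. complex_of_real (g x) * \<phi> i x) \<psi> = (\<Sum>l\<le>row_bound i. entry i l * l2_inner M (\<phi> l) \<psi>)"
proof -
  obtain N where N: "\<And>n x. N \<le> n \<Longrightarrow> complex_of_real (g x) * \<phi> i x = (\<Sum>l\<le>n. entry l i * \<phi> l x)"
    using entry_column[of i] by blast
  define n where "n = max N (row_bound i)"
  have "l2_inner M \<psi> (\<lambda>x. complex_of_real (g x) * \<phi> i x) = (\<Sum>l\<le>n. entry l i * l2_inner M \<psi> (\<phi> l))"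
    using N[of n] by (simp add: n_def l2_inner_sum_right[OF _ \<psi> phi_L2])
  then have "l2_inner M (\<lambda>x. complex_of_real (g x) * \<phi> i x) \<psi> = (\<Sum>l\<le>n. cnj (entry l i) * cnj (l2_inner M \<psi> (\<phi> l)))"
    by (subst l2_inner_commute) simp
  also have "\<dots> = (\<Sum>l\<le>n. entry i l * l2_inner M (\<phi> l) \<psi>)"
    by (simp add: entry_hermitian[of i, symmetric] l2_inner_commute[of M _ \<psi>, symmetric])
  also have "\<dots> = (\<Sum>l\<le>row_bound i. entry i l * l2_inner M (\<phi> l) \<psi>)"
    by (rule row_sum_truncate) (simp add: n_def)
  finally show ?thesis .
qed

lemma fun_span_mult_g:
  assumes "F \<in> fun_span \<phi>"
  shows "(\<lambda>x. complex_of_real (g x) * F x) \<in> fun_span \<phi>"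
proof -
  obtain n c where F: "F = (\<lambda>x. \<Sum>l\<le>n. c l * \<phi> l x)"
    using assms by (auto simp: fun_span_def)
  obtain N where N: "\<And>i m x. N i \<le> m \<Longrightarrow> complex_of_real (g x) * \<phi> i x = (\<Sum>l\<le>m. entry l i * \<phi> l x)"
    using entry_column by metis
  define m where "m = Max (N ` {..n})"
  have m: "N i \<le> m" if "i \<le> n" for i using that by (simp add: m_def)
  have "complex_of_real (g x) * F x = (\<Sum>j\<le>m. (\<Sum>l\<le>n. c l * entry j l) * \<phi> j x)" for x
  proof -
    have "complex_of_real (g x) * F x = (\<Sum>l\<le>n. c l * (complex_of_real (g x) * \<phi> l x))"
      by (simp add: F sum_distrib_left mult_ac)
    also have "\<dots> = (\<Sum>l\<le>n. c l * (\<Sum>j\<le>m. entry j l * \<phi> j x))"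
      using N[OF m] by (intro sum.cong) auto
    also have "\<dots> = (\<Sum>j\<le>m. \<Sum>l\<le>n. c l * (entry j l * \<phi> j x))"
      unfolding sum_distrib_left by (rule sum.swap)
    finally show ?thesis by (simp add: sum_distrib_right mult.assoc)
  qed
  then show ?thesis by (auto simp: fun_span_def)
qed

lemma fun_span_power_g: "(\<lambda>x. complex_of_real (g x ^ k)) \<in> fun_span \<phi>"
proof (induction k)
  case 0
  have "(\<lambda>x. \<Sum>l\<le>0::nat. 1 * \<phi> l x) \<in> fun_span \<phi>" unfolding fun_span_def
    by (intro CollectI exI[of _ 0] exI[of _ "\<lambda>_. 1"] conjI refl TrueI)
  then show ?case by (simp add: phi_0)
next
  case (Suc k)
  from fun_span_mult_g[OF this] show ?case by simp
qed

lemma integrable_power_g: "integrable M (\<lambda>x. g x ^ k)"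
proof -
  have "integrable M (\<lambda>x. cnj (\<phi> 0 x) * complex_of_real (g x ^ k))"
    by (intro L2_product_integrable phi_L2 fun_span_L2 fun_span_power_g)
  then show ?thesis by (simp add: phi_0 complex_of_real_integrable_eq flip: of_real_power)
qed

end

lemma integral_Im_complex:
  fixes f :: "'a \<Rightarrow> complex"
  assumes "integrable M f"
  shows "Im (LINT x|M. f x) = (LINT x|M. Im (f x))" "integrable M (\<lambda>x. Im (f x))"
  using assms by (simp_all add: integral_Im)

context multiplication_matrix
begin

text \<open>Unitary diagonalization of the leading block with indices \<open>0..n\<close>, written in entries: the columns of \<open>u\<close>
are the eigenvectors and \<open>d\<close> the eigenvalues.\<close>

definition diagonalizes :: "nat \<Rightarrow> (nat \<Rightarrow> nat \<Rightarrow> complex) \<Rightarrow> (nat \<Rightarrow> real) \<Rightarrow> bool" where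
  "diagonalizes n u d \<longleftrightarrow>
     (\<forall>i\<le>n. \<forall>j\<le>n. entry i j = (\<Sum>k\<le>n. u i k * complex_of_real (d k) * cnj (u j k))) \<and>
     (\<forall>i\<le>n. \<forall>j\<le>n. (\<Sum>k\<le>n. u i k * cnj (u j k)) = (if i = j then 1 else 0)) \<and>
     (\<forall>k\<le>n. \<forall>l\<le>n. (\<Sum>i\<le>n. cnj (u i k) * u i l) = (if k = l then 1 else 0))"

text \<open>Column 0 of a function of the truncated matrix, where the function is given by its values \<open>h k\<close> at the
eigenvalues.\<close>

definition calculus_column :: "nat \<Rightarrow> (nat \<Rightarrow> nat \<Rightarrow> complex) \<Rightarrow> (nat \<Rightarrow> complex) \<Rightarrow> nat \<Rightarrow> complex" where
  "calculus_column n u h i = (\<Sum>k\<le>n. u i k * h k * cnj (u 0 k))"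

lemma calculus_column_one:
  assumes "diagonalizes n u d" "i \<le> n"
  shows "calculus_column n u (\<lambda>_. 1) i = (if i = 0 then 1 else 0)"
  using assms by (simp add: diagonalizes_def calculus_column_def)

lemma entry_calculus_column:
  assumes ud: "diagonalizes n u d" and i: "i \<le> n"
  shows "(\<Sum>j\<le>n. entry i j * calculus_column n u h j) =
    calculus_column n u (\<lambda>k. complex_of_real (d k) * h k) i"
proof -
  have eig: "(\<Sum>j\<le>n. entry i j * u j k) = complex_of_real (d k) * u i k" if k: "k \<le> n" for k
  proof -
    have "(\<Sum>j\<le>n. entry i j * u j k) =
        (\<Sum>j\<le>n. \<Sum>l\<le>n. u i l * complex_of_real (d l) * (cnj (u j l) * u j k))"
      using ud i by (intro sum.cong refl) (simp add: diagonalizes_def sum_distrib_right mult.assoc)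
    also have "\<dots> = (\<Sum>l\<le>n. u i l * complex_of_real (d l) * (\<Sum>j\<le>n. cnj (u j l) * u j k))"
      unfolding sum_distrib_left by (rule sum.swap)
    also have "\<dots> = (\<Sum>l\<le>n. if l = k then u i l * complex_of_real (d l) else 0)"
      using ud k by (intro sum.cong refl) (simp add: diagonalizes_def)
    finally show ?thesis using k by simp
  qed
  have "(\<Sum>j\<le>n. entry i j * calculus_column n u h j) =
      (\<Sum>j\<le>n. \<Sum>k\<le>n. entry i j * u j k * (h k * cnj (u 0 k)))"
    by (simp add: calculus_column_def sum_distrib_left mult.assoc)
  also have "\<dots> = (\<Sum>k\<le>n. (\<Sum>j\<le>n. entry i j * u j k) * (h k * cnj (u 0 k)))"
    unfolding sum_distrib_right by (rule sum.swap)
  also have "\<dots> = calculus_column n u (\<lambda>k. complex_of_real (d k) * h k) i"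
    unfolding calculus_column_def by (intro sum.cong refl, subst eig) (simp_all add: mult_ac)
  finally show ?thesis .
qed

lemma calculus_column_norm:
  assumes ud: "diagonalizes n u d"
  shows "(\<Sum>i\<le>n. (cmod (calculus_column n u h i))\<^sup>2) = (\<Sum>k\<le>n. (cmod (h k))\<^sup>2 * (cmod (u 0 k))\<^sup>2)"
proof -
  define c where "c k = h k * cnj (u 0 k)" for k
  have "complex_of_real (\<Sum>i\<le>n. (cmod (calculus_column n u h i))\<^sup>2) =
      (\<Sum>i\<le>n. \<Sum>k\<le>n. \<Sum>l\<le>n. c k * (cnj (c l) * (cnj (u i l) * u i k)))"
    unfolding of_real_sum complex_norm_square calculus_column_def
    by (intro sum.cong refl) (simp add: sum_product c_def mult_ac)
  also have "\<dots> = (\<Sum>k\<le>n. \<Sum>i\<le>n. \<Sum>l\<le>n. c k * (cnj (c l) * (cnj (u i l) * u i k)))"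
    by (rule sum.swap)
  also have "\<dots> = (\<Sum>k\<le>n. \<Sum>l\<le>n. c k * (cnj (c l) * (\<Sum>i\<le>n. cnj (u i l) * u i k)))"
    unfolding sum_distrib_left by (intro sum.cong refl sum.swap)
  also have "\<dots> = (\<Sum>k\<le>n. \<Sum>l\<le>n. if l = k then c k * cnj (c l) else 0)"
    using ud by (intro sum.cong refl) (simp add: diagonalizes_def)
  also have "\<dots> = (\<Sum>k\<le>n. c k * cnj (c k))"
    by (intro sum.cong refl) simp
  also have "\<dots> = complex_of_real (\<Sum>k\<le>n. (cmod (h k))\<^sup>2 * (cmod (u 0 k))\<^sup>2)"
    unfolding of_real_sum of_real_mult complex_norm_square c_def by (intro sum.cong refl) (simp add: mult_ac)
  finally show ?thesis by (simp only: of_real_eq_iff)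
qed

lemma calculus_column_0:
  "calculus_column n u (\<lambda>k. complex_of_real (h k)) 0 = complex_of_real (\<Sum>k\<le>n. (cmod (u 0 k))\<^sup>2 * h k)"
  unfolding calculus_column_def of_real_sum of_real_mult complex_norm_square
  by (intro sum.cong refl) (simp add: mult_ac)

text \<open>As long as \<open>g ^ j\<close> lies in the span of \<open>\<phi>\<^sub>0, \<dots>, \<phi>\<^sub>n\<close>, applying the truncated matrix to its
coefficients yields the first \<open>n + 1\<close> coefficients of \<open>g ^ (j + 1)\<close>.\<close>

lemma calculus_column_power:
  assumes ud: "diagonalizes n u d"
    and exact: "\<And>j x. j < k \<Longrightarrow> complex_of_real (g x ^ j) =
      (\<Sum>l\<le>n. l2_inner M (\<phi> l) (\<lambda>x. complex_of_real (g x ^ j)) * \<phi> l x)"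
    and i: "i \<le> n"
  shows "calculus_column n u (\<lambda>l. complex_of_real (d l ^ k)) i = l2_inner M (\<phi> i) (\<lambda>x. complex_of_real (g x ^ k))"
  using exact i
proof (induction k arbitrary: i)
  case 0
  have "l2_inner M (\<phi> i) (\<lambda>x. complex_of_real (g x ^ 0)) = l2_inner M (\<phi> i) (\<phi> 0)"
    by (simp add: phi_0)
  then show ?case using calculus_column_one[OF ud 0(2)] by (simp add: phi_inner)
next
  case (Suc k)
  let ?c = "\<lambda>l. l2_inner M (\<phi> l) (\<lambda>x. complex_of_real (g x ^ k))"
  have IH: "calculus_column n u (\<lambda>l. complex_of_real (d l ^ k)) j = ?c j" if "j \<le> n" for j
    by (rule Suc.IH[OF Suc.prems(1) that]) simp
  have "calculus_column n u (\<lambda>l. complex_of_real (d l ^ Suc k)) i =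
      (\<Sum>j\<le>n. entry i j * calculus_column n u (\<lambda>l. complex_of_real (d l ^ k)) j)"
    unfolding power_Suc of_real_mult by (rule entry_calculus_column[OF ud Suc.prems(2), symmetric])
  also have "\<dots> = (\<Sum>j\<le>n. entry i j * ?c j)"
    by (intro sum.cong refl) (simp only: IH atMost_iff)
  also have "\<dots> = l2_inner M (\<phi> i) (\<lambda>x. \<Sum>j\<le>n. ?c j * (complex_of_real (g x) * \<phi> j x))"
  proof -
    have "l2_inner M (\<phi> i) (\<lambda>x. \<Sum>j\<le>n. ?c j * (complex_of_real (g x) * \<phi> j x)) =
        (\<Sum>j\<le>n. ?c j * l2_inner M (\<phi> i) (\<lambda>x. complex_of_real (g x) * \<phi> j x))"
      by (rule l2_inner_sum_right) (auto intro: phi_L2 fun_span_L2 invariant)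
    then show ?thesis by (simp add: mult_entry_def mult.commute)
  qed
  also have "(\<lambda>x. \<Sum>j\<le>n. ?c j * (complex_of_real (g x) * \<phi> j x)) = (\<lambda>x. complex_of_real (g x ^ Suc k))"
  proof
    fix x
    have "complex_of_real (g x ^ Suc k) = complex_of_real (g x) * complex_of_real (g x ^ k)"
      by simp
    also have "\<dots> = (\<Sum>j\<le>n. ?c j * (complex_of_real (g x) * \<phi> j x))"
      by (subst Suc.prems(1)[of k x]) (simp_all add: sum_distrib_left mult.left_commute)
    finally show "(\<Sum>j\<le>n. ?c j * (complex_of_real (g x) * \<phi> j x)) = complex_of_real (g x ^ Suc k)" ..
  qed
  finally show ?case .
qed

theorem truncated_moments_exact:
  "\<exists>N. \<forall>n\<ge>N. \<forall>u d. diagonalizes n u d \<longrightarrow> (\<Sum>l\<le>n. (cmod (u 0 l))\<^sup>2 * d l ^ k) = (LINT x|M. g x ^ k)"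
proof -
  have "\<exists>N. \<forall>n\<ge>N. \<forall>x. complex_of_real (g x ^ j) =
      (\<Sum>l\<le>n. l2_inner M (\<phi> l) (\<lambda>x. complex_of_real (g x ^ j)) * \<phi> l x)" for j
    using fun_span_expansion[OF fun_span_power_g[of j]] by blast
  then obtain N where N: "\<And>j n x. N j \<le> n \<Longrightarrow> complex_of_real (g x ^ j) =
      (\<Sum>l\<le>n. l2_inner M (\<phi> l) (\<lambda>x. complex_of_real (g x ^ j)) * \<phi> l x)"
    by metis
  have "(\<Sum>l\<le>n. (cmod (u 0 l))\<^sup>2 * d l ^ k) = (LINT x|M. g x ^ k)"
    if n: "Max (N ` {..k}) \<le> n" and ud: "diagonalizes n u d" for n u d
  proof -
    have "N j \<le> n" if "j < k" for j
      using n that by (intro order_trans[OF Max_ge n]) auto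
    then have "calculus_column n u (\<lambda>l. complex_of_real (d l ^ k)) 0 = l2_inner M (\<phi> 0) (\<lambda>x. complex_of_real (g x ^ k))"
      by (intro calculus_column_power[OF ud] N) auto
    also have "\<dots> = complex_of_real (LINT x|M. g x ^ k)"
      unfolding integral_complex_of_real[symmetric] by (simp add: l2_inner_def phi_0)
    finally show ?thesis
      unfolding calculus_column_0 by (simp only: of_real_eq_iff)
  qed
  then show ?thesis by blast
qed

definition resolvent_fun :: "complex \<Rightarrow> 'a \<Rightarrow> complex" where
  "resolvent_fun z x = 1 / (complex_of_real (g x) - z)"

lemma resolvent_bound:
  fixes t :: real
  assumes z: "Im z \<noteq> 0"
  shows "cmod (1 / (complex_of_real t - z)) \<le> 1 / \<bar>Im z\<bar>" "complex_of_real t - z \<noteq> 0"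
proof -
  have le: "\<bar>Im z\<bar> \<le> cmod (complex_of_real t - z)"
    using abs_Im_le_cmod[of "complex_of_real t - z"] by simp
  then show "complex_of_real t - z \<noteq> 0" using z by auto
  show "cmod (1 / (complex_of_real t - z)) \<le> 1 / \<bar>Im z\<bar>"
    using le z by (simp add: norm_divide frac_le)
qed

lemma resolvent_fun_L2:
  assumes z: "Im z \<noteq> 0"
  shows "resolvent_fun z \<in> L2 M"
proof -
  have m [measurable]: "resolvent_fun z \<in> borel_measurable M"
    unfolding resolvent_fun_def by measurable
  have "integrable M (\<lambda>x. (cmod (resolvent_fun z x))\<^sup>2)"
  proof (rule integrable_const_bound[where B="(1 / \<bar>Im z\<bar>)\<^sup>2"])
    show "AE x in M. norm ((cmod (resolvent_fun z x))\<^sup>2) \<le> (1 / \<bar>Im z\<bar>)\<^sup>2"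
      unfolding resolvent_fun_def using resolvent_bound(1)[OF z] by (intro AE_I2) (simp add: power_mono)
  qed measurable
  then show ?thesis using m by (simp add: L2_def)
qed

text \<open>From \<open>g/(g - z) = 1 + z/(g - z)\<close>: the coefficients of \<open>1/(g - z)\<close> solve \<open>(M\<^sub>\<infinity> - z) v = e\<^sub>0\<close>.\<close>

lemma resolvent_coefficients:
  assumes z: "Im z \<noteq> 0"
  shows "(\<Sum>l\<le>row_bound i. entry i l * l2_inner M (\<phi> l) (resolvent_fun z)) =
    z * l2_inner M (\<phi> i) (resolvent_fun z) + (if i = 0 then 1 else 0)"
proof -
  have "complex_of_real (g x) * resolvent_fun z x = \<phi> 0 x + z * resolvent_fun z x" for x
    using resolvent_bound(2)[OF z, of "g x"] by (simp add: resolvent_fun_def phi_0 field_simps)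
  then have "l2_inner M (\<phi> i) (\<lambda>x. complex_of_real (g x) * resolvent_fun z x) =
      (LINT x|M. cnj (\<phi> i x) * \<phi> 0 x + z * (cnj (\<phi> i x) * resolvent_fun z x))"
    by (simp add: l2_inner_def algebra_simps)
  also have "\<dots> = l2_inner M (\<phi> i) (\<phi> 0) + z * l2_inner M (\<phi> i) (resolvent_fun z)"
    unfolding l2_inner_def
    by (subst Bochner_Integration.integral_add[OF L2_product_integrable[OF phi_L2 phi_L2]
        integrable_mult_right[OF L2_product_integrable[OF phi_L2 resolvent_fun_L2[OF z]]]]) simp
  finally show ?thesis
    using inner_row[OF resolvent_fun_L2[OF z], of i]
    by (cases "i = 0") (simp_all add: inner_mult_g phi_inner add.commute)
qed

text \<open>The vector \<open>(M\<^sub>n - z)\<^sup>-\<^sup>1 e\<^sub>0\<close>, extended by 0 to an infinite sequence.\<close>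

definition truncated_resolvent :: "nat \<Rightarrow> (nat \<Rightarrow> nat \<Rightarrow> complex) \<Rightarrow> (nat \<Rightarrow> real) \<Rightarrow> complex \<Rightarrow> nat \<Rightarrow> complex" where
  "truncated_resolvent n u d z i =
     (if i \<le> n then calculus_column n u (\<lambda>k. 1 / (complex_of_real (d k) - z)) i else 0)"

text \<open>Once \<open>n\<close> exceeds \<open>row_bound i\<close>, row \<open>i\<close> of the truncated matrix agrees with the full row.\<close>

lemma truncated_resolvent_equation:
  assumes ud: "diagonalizes n u d" and z: "Im z \<noteq> 0" and n: "row_bound i \<le> n" "i \<le> n"
  shows "(\<Sum>l\<le>row_bound i. entry i l * truncated_resolvent n u d z l) =
    z * truncated_resolvent n u d z i + (if i = 0 then 1 else 0)"
proof -
  have "(\<Sum>l\<le>row_bound i. entry i l * truncated_resolvent n u d z l) =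
      (\<Sum>l\<le>n. entry i l * calculus_column n u (\<lambda>k. 1 / (complex_of_real (d k) - z)) l)"
    unfolding row_sum_truncate[OF n(1), symmetric] by (intro sum.cong) (auto simp: truncated_resolvent_def)
  also have "\<dots> = calculus_column n u (\<lambda>k. complex_of_real (d k) * (1 / (complex_of_real (d k) - z))) i"
    by (rule entry_calculus_column[OF ud n(2)])
  also have "(\<lambda>k. complex_of_real (d k) * (1 / (complex_of_real (d k) - z))) =
      (\<lambda>k. z * (1 / (complex_of_real (d k) - z)) + 1)"
    using resolvent_bound(2)[OF z] by (simp add: field_simps)
  also have "calculus_column n u (\<lambda>k. z * (1 / (complex_of_real (d k) - z)) + 1) i =
      z * calculus_column n u (\<lambda>k. 1 / (complex_of_real (d k) - z)) i + calculus_column n u (\<lambda>_. 1) i"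
    unfolding calculus_column_def
    by (simp add: sum_distrib_left distrib_left distrib_right sum.distrib mult_ac)
  finally show ?thesis
    using n by (simp add: calculus_column_one[OF ud] truncated_resolvent_def)
qed

text \<open>The bound \<open>1/\<bar>Im z\<bar>\<close> on the resolvent of a self-adjoint matrix, uniform in the truncation.\<close>

lemma truncated_resolvent_norm:
  assumes ud: "diagonalizes n u d" and z: "Im z \<noteq> 0"
  shows "(\<Sum>i<m. (cmod (truncated_resolvent n u d z i))\<^sup>2) \<le> (1 / \<bar>Im z\<bar>)\<^sup>2"
proof -
  have "(\<Sum>i<m. (cmod (truncated_resolvent n u d z i))\<^sup>2) \<le> (\<Sum>i\<in>{..<m} \<union> {..n}. (cmod (truncated_resolvent n u d z i))\<^sup>2)"
    by (intro sum_mono2) auto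
  also have "\<dots> = (\<Sum>i\<le>n. (cmod (calculus_column n u (\<lambda>k. 1 / (complex_of_real (d k) - z)) i))\<^sup>2)"
    by (intro sum.mono_neutral_cong_right) (auto simp: truncated_resolvent_def)
  also have "\<dots> = (\<Sum>k\<le>n. (cmod (1 / (complex_of_real (d k) - z)))\<^sup>2 * (cmod (u 0 k))\<^sup>2)"
    by (rule calculus_column_norm[OF ud])
  also have "\<dots> \<le> (\<Sum>k\<le>n. (1 / \<bar>Im z\<bar>)\<^sup>2 * (cmod (u 0 k))\<^sup>2)"
    by (intro sum_mono mult_right_mono power_mono resolvent_bound(1)[OF z]) auto
  also have "\<dots> = (1 / \<bar>Im z\<bar>)\<^sup>2"
  proof -
    have "complex_of_real (\<Sum>k\<le>n. (cmod (u 0 k))\<^sup>2 * 1) = 1"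
      using calculus_column_one[OF ud, of 0] calculus_column_0[of n u "\<lambda>_. 1"] by simp
    then have "(\<Sum>k\<le>n. (cmod (u 0 k))\<^sup>2) = 1"
      by (simp only: of_real_eq_1_iff mult_1_right)
    then show ?thesis by (simp only: sum_distrib_left[symmetric] mult_1_right)
  qed
  finally show ?thesis .
qed

text \<open>A compactness argument. If convergence failed, some subsequence would stay away from the limit; along a
further subsequence all coordinates converge, and the difference \<open>\<delta>\<close> of the limit and of the coefficients of
\<open>1/(g - z)\<close> solves \<open>M\<^sub>\<infinity> \<delta> = z \<delta>\<close> with nonreal \<open>z\<close>, hence vanishes.\<close>

theorem truncated_resolvent_tendsto:
  assumes sa: "self_adjoint ell2_measure (matrix_op entry)"
    and ud: "\<And>n. diagonalizes n (u n) (d n)" and z: "Im z \<noteq> 0"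
  shows "(\<lambda>n. truncated_resolvent n (u n) (d n) z 0) \<longlonglongrightarrow> (LINT x|M. resolvent_fun z x)"
proof (rule ccontr)
  define L where "L = (LINT x|M. resolvent_fun z x)"
  define r where "r n i = truncated_resolvent n (u n) (d n) z i" for n i
  define C where "C = (1 / \<bar>Im z\<bar>)\<^sup>2"
  assume "\<not> (\<lambda>n. truncated_resolvent n (u n) (d n) z 0) \<longlonglongrightarrow> (LINT x|M. resolvent_fun z x)"
  then have "\<exists>\<epsilon>>0. \<forall>N. \<exists>n\<ge>N. \<epsilon> \<le> dist (r n 0) L"
    unfolding lim_sequentially L_def[symmetric] r_def[symmetric] by (simp add: not_less)
  then obtain \<epsilon> where \<epsilon>: "\<epsilon> > 0" "\<forall>N. \<exists>n\<ge>N. \<epsilon> \<le> dist (r n 0) L"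
    by (elim exE conjE)
  have "infinite {n. \<epsilon> \<le> dist (r n 0) L}"
    unfolding infinite_nat_iff_unbounded_le mem_Collect_eq by (rule \<epsilon>(2))
  from infinite_enumerate[OF this] obtain s :: "nat \<Rightarrow> nat"
    where "strict_mono s \<and> (\<forall>n. s n \<in> {n. \<epsilon> \<le> dist (r n 0) L})"
    by (rule exE)
  then have s: "strict_mono s" "\<And>n. \<epsilon> \<le> dist (r (s n) 0) L"
    by simp_all
  have r_norm: "(\<Sum>i<m. (cmod (r n i))\<^sup>2) \<le> C" for n m
    unfolding r_def C_def by (rule truncated_resolvent_norm[OF ud z])
  have r_bound: "cmod (r (s n) i) \<le> 1 / \<bar>Im z\<bar>" for n i
  proof -
    have "(cmod (r (s n) i))\<^sup>2 \<le> (\<Sum>j<Suc i. (cmod (r (s n) j))\<^sup>2)"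
      by (simp add: sum_nonneg)
    also have "\<dots> \<le> (1 / \<bar>Im z\<bar>)\<^sup>2"
      unfolding C_def[symmetric] by (rule r_norm)
    finally show ?thesis by (rule power2_le_imp_le) simp
  qed
  have "\<exists>k :: nat \<Rightarrow> nat. strict_mono k \<and> (\<forall>i. \<exists>l. (\<lambda>n. r (s (k n)) i) \<longlonglongrightarrow> l)"
  proof (rule function_convergent_subsequence[of "UNIV :: nat set" "\<lambda>n. r (s n)"])
    show "cmod (r (s n) i) \<le> 1 / \<bar>Im z\<bar>" for n i by (rule r_bound)
    fix k :: "nat \<Rightarrow> nat"
    assume "strict_mono k" "\<And>i. i \<in> UNIV \<Longrightarrow> \<exists>l. (\<lambda>n. r (s (k n)) i) \<longlonglongrightarrow> l"
    then show "\<exists>k :: nat \<Rightarrow> nat. strict_mono k \<and> (\<forall>i. \<exists>l. (\<lambda>n. r (s (k n)) i) \<longlonglongrightarrow> l)"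
      by (intro exI[of _ k] conjI allI) simp_all
  qed simp
  then obtain k :: "nat \<Rightarrow> nat"
    where k: "strict_mono k \<and> (\<forall>i. \<exists>l. (\<lambda>n. r (s (k n)) i) \<longlonglongrightarrow> l)"
    by (rule exE)
  obtain v where v: "\<And>i. (\<lambda>n. r (s (k n)) i) \<longlonglongrightarrow> v i"
    using choice[OF conjunct2[OF k]] by (auto simp only:)
  \<comment> \<open>From here on \<open>v\<close> is shown to be an \<open>\<ell>\<^sup>2\<close> solution of the resolvent equation of the infinite matrix.\<close>
  have sk: "strict_mono (\<lambda>n. s (k n))"
    using s(1) conjunct1[OF k] by (simp add: strict_mono_def)
  have v_row: "(\<Sum>l\<le>row_bound i. entry i l * v l) = z * v i + (if i = 0 then 1 else 0)" for i
  proof (rule LIMSEQ_unique)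
    show "(\<lambda>n. \<Sum>l\<le>row_bound i. entry i l * r (s (k n)) l) \<longlonglongrightarrow> (\<Sum>l\<le>row_bound i. entry i l * v l)"
      by (intro tendsto_intros v)
    have "eventually (\<lambda>n. max i (row_bound i) \<le> s (k n)) sequentially"
      using filterlim_subseq[OF sk] by (simp add: filterlim_at_top del: max.bounded_iff)
    then have "eventually (\<lambda>n. z * r (s (k n)) i + (if i = 0 then 1 else 0) =
        (\<Sum>l\<le>row_bound i. entry i l * r (s (k n)) l)) sequentially"
      by eventually_elim (simp add: r_def truncated_resolvent_equation[OF ud z])
    moreover have "(\<lambda>n. z * r (s (k n)) i + (if i = 0 then 1 else 0)) \<longlonglongrightarrow> z * v i + (if i = 0 then 1 else 0)"
      by (intro tendsto_intros v)
    ultimately show "(\<lambda>n. \<Sum>l\<le>row_bound i. entry i l * r (s (k n)) l) \<longlonglongrightarrow> z * v i + (if i = 0 then 1 else 0)"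
      by (rule Lim_transform_eventually[rotated])
  qed
  have v_L2: "v \<in> L2 ell2_measure"
  proof (rule L2_ell2_bounded)
    fix m
    have "(\<lambda>n. \<Sum>i<m. (cmod (r (s (k n)) i))\<^sup>2) \<longlonglongrightarrow> (\<Sum>i<m. (cmod (v i))\<^sup>2)"
      by (intro tendsto_intros v)
    then show "(\<Sum>i<m. (cmod (v i))\<^sup>2) \<le> C"
      by (rule LIMSEQ_le_const2) (auto intro: r_norm)
  qed
  define v' where "v' i = l2_inner M (\<phi> i) (resolvent_fun z)" for i
  have v'_row: "(\<Sum>l\<le>row_bound i. entry i l * v' l) = z * v' i + (if i = 0 then 1 else 0)" for i
    unfolding v'_def by (rule resolvent_coefficients[OF z])
  have v'_L2: "v' \<in> L2 ell2_measure"
    unfolding v'_def by (rule L2_ell2_bounded, rule bessel_inequality[OF orth resolvent_fun_L2[OF z]])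
  define \<delta> where "\<delta> i = v i - v' i" for i
  have \<delta>_L2: "\<delta> \<in> L2 ell2_measure"
    using L2_add[OF v_L2 L2_cmult[OF v'_L2, of "-1"]] by (simp add: \<delta>_def[abs_def])
  have "(\<delta>, \<lambda>i. z * \<delta> i) \<in> matrix_op entry"
  proof -
    have "z * \<delta> i = suminf (\<lambda>j. entry i j * \<delta> j)" for i
      unfolding suminf_row using v_row[of i] v'_row[of i]
      by (simp add: \<delta>_def right_diff_distrib sum_subtractf)
    then show ?thesis
      unfolding matrix_op_def mem_Collect_eq case_prod_conv
      using \<delta>_L2 L2_cmult[OF \<delta>_L2, of z] by (intro conjI allI)
  qed
  from self_adjoint_no_nonreal_eigenvalue[OF sa this z]
  have "suminf (\<lambda>i. (cmod (\<delta> i))\<^sup>2) = 0"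
    using L2_square_integrable[OF \<delta>_L2] by (simp add: integral_count_space_nat)
  then have "(cmod (\<delta> 0))\<^sup>2 = 0"
    using \<delta>_L2 by (simp add: L2_ell2_iff suminf_eq_zero_iff)
  then have "v 0 = v' 0" by (simp add: \<delta>_def)
  also have "v' 0 = L" by (simp add: v'_def l2_inner_def phi_0 L_def)
  finally have "(\<lambda>n. r (s (k n)) 0) \<longlonglongrightarrow> L" using v[of 0] by simp
  then obtain n where "dist (r (s (k n)) 0) L < \<epsilon>"
    using \<epsilon>(1) by (auto simp: lim_sequentially)
  with s(2)[of "k n"] show False by simp
qed

end

lemma poisson_resolvent: "poisson y s x = Im (1 / (complex_of_real x - Complex s y))"
  by (simp add: poisson_def Im_divide power2_eq_square)

context multiplication_matrix
begin

text \<open>One diagonalization serves all \<open>f\<close>, so the nodes and weights of the quadrature do not depend on \<open>f\<close>.\<close>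

lemma trunc_matrix_functional_calculus:
  "\<exists>u d. diagonalizes n u d \<and> (\<forall>f. hermitian_fun f (trunc_matrix entry n) $$ (0, 0) =
     complex_of_real (\<Sum>k\<le>n. (cmod (u 0 k))\<^sup>2 * f (d k)))"
proof -
  define A where "A = trunc_matrix entry n"
  have A: "A \<in> carrier_mat (Suc n) (Suc n)" by (simp add: A_def trunc_matrix_def)
  have A_index: "A $$ (i, j) = entry i j" if "i \<le> n" "j \<le> n" for i j
    using that by (simp add: A_def trunc_matrix_def)
  have "mat_adjoint A = A"
    using A by (intro eq_matI) (auto simp: A_index less_Suc_eq_le entry_hermitian[symmetric])
  from hermitian_unitary_diagonalization[OF A this] obtain U d
    where U: "U \<in> carrier_mat (Suc n) (Suc n)" "mat_adjoint U * U = 1\<^sub>m (Suc n)"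
      and AU: "A = U * mat_diag (Suc n) (\<lambda>i. complex_of_real (d i)) * mat_adjoint U"
    by blast
  have right: "U * mat_adjoint U = 1\<^sub>m (Suc n)"
    using mat_mult_left_right_inverse[OF mat_adjoint_carrier[OF U(1)] U(1) U(2)] .
  define u where "u i k = U $$ (i, k)" for i k
  have "entry i j = (\<Sum>k\<le>n. u i k * complex_of_real (d k) * cnj (u j k))" if "i \<le> n" "j \<le> n" for i j
    using unitary_conjugation_index[OF U(1), of i j "\<lambda>i. complex_of_real (d i)"] that
    by (simp add: AU[symmetric] A_index u_def lessThan_Suc_atMost)
  moreover have "(\<Sum>k\<le>n. u i k * cnj (u j k)) = (if i = j then 1 else 0)" if "i \<le> n" "j \<le> n" for i j
    using arg_cong[OF right, of "\<lambda>B. B $$ (i, j)"] that U(1)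
    by (simp add: u_def scalar_prod_def atLeast0LessThan lessThan_Suc_atMost)
  moreover have "(\<Sum>i\<le>n. cnj (u i k) * u i l) = (if k = l then 1 else 0)" if "k \<le> n" "l \<le> n" for k l
    using arg_cong[OF U(2), of "\<lambda>B. B $$ (k, l)"] that U(1)
    by (simp add: u_def scalar_prod_def atLeast0LessThan lessThan_Suc_atMost)
  ultimately have "diagonalizes n u d" by (simp add: diagonalizes_def)
  moreover have "hermitian_fun f A $$ (0, 0) = complex_of_real (\<Sum>k\<le>n. (cmod (u 0 k))\<^sup>2 * f (d k))" for f
    unfolding hermitian_fun_eq[OF A U AU] unitary_conjugation_index[OF U(1) zero_less_Suc zero_less_Suc]
      of_real_sum of_real_mult complex_norm_square u_def[symmetric] lessThan_Suc_atMost
    by (simp add: mult_ac)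
  ultimately show ?thesis unfolding A_def by blast
qed

text \<open>The Poisson kernel at height \<open>y\<close> over \<open>s\<close> is the imaginary part of the resolvent at \<open>s + iy\<close>.\<close>

lemma diagonalizes_poisson_quadrature:
  assumes sa: "self_adjoint ell2_measure (matrix_op entry)"
    and ud: "\<And>n. diagonalizes n (u n) (d n)"
  shows "poisson_quadrature (distr M borel g) (\<lambda>n k. (cmod (u n 0 k))\<^sup>2) d"
proof -
  interpret mu: real_distribution "distr M borel g" by simp
  interpret quadrature "distr M borel g" "\<lambda>n k. (cmod (u n 0 k))\<^sup>2" d
  proof
    fix n
    have "complex_of_real (\<Sum>k\<le>n. (cmod (u n 0 k))\<^sup>2 * 1) = 1"
      using calculus_column_one[OF ud, of 0 n] calculus_column_0[of n "u n" "\<lambda>_. 1"] by simp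
    then show "(\<Sum>k\<le>n. (cmod (u n 0 k))\<^sup>2) = 1"
      by (simp only: of_real_eq_1_iff mult_1_right)
  qed simp
  show ?thesis
  proof
    fix y s :: real assume y: "y > 0"
    define z where "z = Complex s y"
    have z: "Im z \<noteq> 0" using y by (simp add: z_def)
    have [measurable]: "poisson y s \<in> borel_measurable borel"
      unfolding poisson_def by measurable
    have res: "integrable M (resolvent_fun z)"
      using L2_product_integrable[OF phi_L2[of 0] resolvent_fun_L2[OF z]] by (simp add: phi_0)
    have Im_res: "Im (resolvent_fun z x) = poisson y s (g x)" for x
      by (simp add: resolvent_fun_def poisson_resolvent z_def)
    have int: "integrable (distr M borel g) (poisson y s)"
      using integral_Im_complex(2)[OF res] by (simp add: Im_res integrable_distr_eq)
    have val: "(LINT x|distr M borel g. poisson y s x) = Im (LINT x|M. resolvent_fun z x)"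
      using integral_Im_complex(1)[OF res] by (simp add: Im_res integral_distr)
    have Im_real_mult: "Im (complex_of_real r * w) = r * Im w" for r w by simp
    have "Im (truncated_resolvent n (u n) (d n) z 0) = quad n (poisson y s)" for n
    proof -
      have "u n 0 k * (1 / (complex_of_real (d n k) - z)) * cnj (u n 0 k) =
          complex_of_real ((cmod (u n 0 k))\<^sup>2) * (1 / (complex_of_real (d n k) - z))" for k
        by (simp only: complex_norm_square mult_ac)
      then have "Im (u n 0 k * (1 / (complex_of_real (d n k) - z)) * cnj (u n 0 k)) =
          (cmod (u n 0 k))\<^sup>2 * poisson y s (d n k)" for k
        unfolding poisson_resolvent z_def[symmetric] by (simp only: Im_real_mult)
      then show ?thesis
        by (simp add: truncated_resolvent_def calculus_column_def quad_def)
    qed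
    with tendsto_Im[OF truncated_resolvent_tendsto[OF sa ud z]] int val
    show "converges (poisson y s)" by (simp add: converges_def)
  qed
qed

end

section \<open>Polynomials in several variables\<close>

definition monomial_value :: "('d::finite \<Rightarrow>\<^sub>0 nat) \<Rightarrow> real ^ 'd \<Rightarrow> real" where
  "monomial_value \<alpha> x = (\<Prod>i\<in>UNIV. vec_nth x i ^ Poly_Mapping.lookup \<alpha> i)"

lemma monomial_value_add: "monomial_value (\<alpha> + \<beta>) x = monomial_value \<alpha> x * monomial_value \<beta> x"
  by (simp add: monomial_value_def lookup_add power_add prod.distrib)

lemma eval_mpoly_superset:
  assumes "finite A" "Poly_Mapping.keys p \<subseteq> A"
  shows "eval_mpoly p x = (\<Sum>\<alpha>\<in>A. Poly_Mapping.lookup p \<alpha> * of_real (monomial_value \<alpha> x))"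
  unfolding eval_mpoly_def monomial_value_def[symmetric] using assms
  by (intro sum.mono_neutral_left) (auto simp: in_keys_iff)

lemma eval_mpoly_add: "eval_mpoly (p + q) x = eval_mpoly p x + eval_mpoly q x"
proof -
  let ?A = "Poly_Mapping.keys p \<union> Poly_Mapping.keys q"
  have A: "finite ?A" "Poly_Mapping.keys (p + q) \<subseteq> ?A" by (simp_all add: keys_add)
  show ?thesis
    unfolding eval_mpoly_superset[OF A] eval_mpoly_superset[OF A(1) Un_upper1] eval_mpoly_superset[OF A(1) Un_upper2]
    by (simp add: lookup_add distrib_right sum.distrib)
qed

lemma eval_mpoly_single: "eval_mpoly (Poly_Mapping.single \<alpha> c) x = c * of_real (monomial_value \<alpha> x)"
  by (subst eval_mpoly_superset[of "{\<alpha>}"]) (auto split: if_splits)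

lemma eval_mpoly_sum: "finite I \<Longrightarrow> eval_mpoly (\<Sum>i\<in>I. p i) x = (\<Sum>i\<in>I. eval_mpoly (p i) x)"
proof (induction I rule: finite_induct)
  case empty
  show ?case by (simp add: eval_mpoly_def)
qed (simp add: eval_mpoly_add)

lemma eval_mpoly_one: "eval_mpoly 1 x = 1"
  unfolding single_one[symmetric] eval_mpoly_single by (simp add: monomial_value_def)

text \<open>The product is assembled from monomials, which avoids the convolution in the definition of
multiplication of finitely supported maps.\<close>

lemma eval_mpoly_real_times:
  fixes p :: "('d::finite, real) mpolynomial" and q :: "('d, complex) mpolynomial"
  shows "\<exists>r. \<forall>x. complex_of_real (eval_mpoly p x) * eval_mpoly q x = eval_mpoly r x"
proof (intro exI allI)
  fix x
  let ?r = "\<Sum>\<alpha>\<in>Poly_Mapping.keys p. \<Sum>\<beta>\<in>Poly_Mapping.keys q.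
      Poly_Mapping.single (\<alpha> + \<beta>) (complex_of_real (Poly_Mapping.lookup p \<alpha>) * Poly_Mapping.lookup q \<beta>)"
  have "eval_mpoly ?r x = (\<Sum>\<alpha>\<in>Poly_Mapping.keys p. \<Sum>\<beta>\<in>Poly_Mapping.keys q.
      complex_of_real (Poly_Mapping.lookup p \<alpha>) * Poly_Mapping.lookup q \<beta> *
      complex_of_real (monomial_value (\<alpha> + \<beta>) x))"
    by (simp add: eval_mpoly_sum eval_mpoly_single)
  then show "complex_of_real (eval_mpoly p x) * eval_mpoly q x = eval_mpoly ?r x"
    unfolding eval_mpoly_superset[OF finite_keys order_refl, of p]
      eval_mpoly_superset[OF finite_keys order_refl, of q]
    by (simp only: of_real_sum sum_product) (simp add: monomial_value_add mult_ac)
qed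

lemma continuous_on_eval_mpoly:
  fixes p :: "('d::finite, 'a::real_normed_algebra_1) mpolynomial"
  shows "continuous_on S (eval_mpoly p)"
proof -
  have "continuous_on S (\<lambda>x. eval_mpoly p x)"
    unfolding eval_mpoly_def by (intro continuous_intros)
  then show ?thesis by simp
qed

lemma spans_by_degree_fun_span:
  assumes "spans_by_degree \<phi>"
  shows "eval_mpoly q \<in> fun_span (\<lambda>i. eval_mpoly (\<phi> i))"
proof -
  obtain n c where "\<forall>x. eval_mpoly q x = (\<Sum>i\<le>n. c i * eval_mpoly (\<phi> i) x)"
    using assms unfolding spans_by_degree_def by (meson order_refl)
  then have "eval_mpoly q = (\<lambda>x. \<Sum>i\<le>n. c i * eval_mpoly (\<phi> i) x)"
    by (intro ext) simp
  then show ?thesis unfolding fun_span_def by blast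
qed

section \<open>Measures with a density on a complete space\<close>

lemma complete_measure_lebesgue_on:
  assumes "\<Omega> \<in> sets lebesgue"
  shows "complete_measure (lebesgue_on \<Omega>)"
proof
  fix A B assume "B \<subseteq> A" "A \<in> null_sets (lebesgue_on \<Omega>)"
  then have "B \<subseteq> \<Omega>" "A \<in> null_sets lebesgue"
    using assms by (auto simp: null_sets_restrict_space)
  then have "B \<in> null_sets lebesgue"
    using \<open>B \<subseteq> A\<close> completion.complete2 by blast
  then show "B \<in> sets (lebesgue_on \<Omega>)"
    using assms \<open>B \<subseteq> \<Omega>\<close> by (simp add: sets_restrict_space_iff null_setsD2)
qed

lemma (in complete_measure) borel_measurable_cong_AE:
  fixes f h :: "'a \<Rightarrow> real"
  assumes f: "f \<in> borel_measurable M" and ae: "AE x in M. f x = h x"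
  shows "h \<in> borel_measurable M"
proof (rule measurableI)
  fix A :: "real set" assume "A \<in> sets borel"
  then have "f -` A \<inter> space M \<in> sets M" by (rule measurable_sets[OF f])
  moreover have "AE x in M. x \<in> f -` A \<inter> space M \<longleftrightarrow> x \<in> h -` A \<inter> space M"
    using ae by eventually_elim simp
  ultimately show "h -` A \<inter> space M \<in> sets M"
    by (intro in_sets_AE[of "f -` A \<inter> space M" "h -` A \<inter> space M"] Int_lower2)
qed simp

text \<open>Along a subsequence the lower functions converge to \<open>F\<close> almost everywhere. Measurability of \<open>F\<close> is a
conclusion here, and this is where completeness is needed.\<close>

lemma (in complete_measure) integrable_sandwich:
  fixes F :: "'a \<Rightarrow> real"
  assumes sandwich: "\<And>\<epsilon>. \<epsilon> > 0 \<Longrightarrow> \<exists>l u. integrable M l \<and> integrable M u \<and>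
    (\<forall>x\<in>space M. l x \<le> F x \<and> F x \<le> u x) \<and> (LINT x|M. u x) - (LINT x|M. l x) < \<epsilon>"
  shows "integrable M F"
proof -
  have "\<forall>n. \<exists>l u. integrable M l \<and> integrable M u \<and>
    (\<forall>x\<in>space M. l x \<le> F x \<and> F x \<le> u x) \<and> (LINT x|M. u x) - (LINT x|M. l x) < inverse (real (Suc n))"
    by (intro allI sandwich) simp
  then obtain l where "\<forall>n. \<exists>u. integrable M (l n) \<and> integrable M u \<and>
    (\<forall>x\<in>space M. l n x \<le> F x \<and> F x \<le> u x) \<and> (LINT x|M. u x) - (LINT x|M. l n x) < inverse (real (Suc n))"
    by (rule choice[THEN exE])
  then obtain u where lu: "\<forall>n. integrable M (l n) \<and> integrable M (u n) \<and>
    (\<forall>x\<in>space M. l n x \<le> F x \<and> F x \<le> u n x) \<and> (LINT x|M. u n x) - (LINT x|M. l n x) < inverse (real (Suc n))"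
    by (rule choice[THEN exE])
  then have l: "\<And>n. integrable M (l n)" and u: "\<And>n. integrable M (u n)"
    and lF: "\<And>n x. x \<in> space M \<Longrightarrow> l n x \<le> F x" and Fu: "\<And>n x. x \<in> space M \<Longrightarrow> F x \<le> u n x"
    and small: "\<And>n. (LINT x|M. u n x) - (LINT x|M. l n x) < inverse (real (Suc n))"
    by simp_all
  have gap: "(LINT x|M. norm (u n x - l n x)) = (LINT x|M. u n x) - (LINT x|M. l n x)" for n
  proof -
    have "(LINT x|M. norm (u n x - l n x)) = (LINT x|M. u n x - l n x)"
      using order_trans[OF lF Fu] by (intro Bochner_Integration.integral_cong) auto
    then show ?thesis using l u by simp
  qed
  have "(\<lambda>n. LINT x|M. norm (u n x - l n x)) \<longlonglongrightarrow> 0"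
  proof (rule tendsto_sandwich[OF _ _ tendsto_const LIMSEQ_inverse_real_of_nat])
    show "\<forall>\<^sub>F n in sequentially. 0 \<le> (LINT x|M. norm (u n x - l n x))" by simp
    show "\<forall>\<^sub>F n in sequentially. (LINT x|M. norm (u n x - l n x)) \<le> inverse (real (Suc n))"
      unfolding gap using small less_imp_le by (intro always_eventually allI) blast
  qed
  then obtain r where "AE x in M. (\<lambda>n. u (r n) x - l (r n) x) \<longlonglongrightarrow> 0"
    using tendsto_L1_AE_subseq[of M "\<lambda>n x. u n x - l n x"] l u by auto
  then have "AE x in M. lim (\<lambda>n. l (r n) x) = F x"
  proof (rule AE_mp, intro AE_I2 impI)
    fix x assume x: "x \<in> space M" and lim0: "(\<lambda>n. u (r n) x - l (r n) x) \<longlonglongrightarrow> 0"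
    have "(\<lambda>n. F x - l (r n) x) \<longlonglongrightarrow> 0"
      by (rule tendsto_sandwich[OF _ _ tendsto_const lim0])
        (use lF[OF x] Fu[OF x] in \<open>auto intro: always_eventually\<close>)
    then have "(\<lambda>n. F x - (F x - l (r n) x)) \<longlonglongrightarrow> F x - 0"
      by (intro tendsto_diff tendsto_const)
    then show "lim (\<lambda>n. l (r n) x) = F x"
      by (simp add: limI)
  qed
  moreover have "(\<lambda>x. lim (\<lambda>n. l (r n) x)) \<in> borel_measurable M"
    using l by (intro borel_measurable_lim_metric) auto
  ultimately have F: "F \<in> borel_measurable M"
    by (rule borel_measurable_cong_AE[rotated])
  show ?thesis
  proof (rule Bochner_Integration.integrable_bound[OF _ F])
    show "integrable M (\<lambda>x. \<bar>l 0 x\<bar> + \<bar>u 0 x\<bar>)" using l u by auto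
    show "AE x in M. norm (F x) \<le> norm (\<bar>l 0 x\<bar> + \<bar>u 0 x\<bar>)"
    proof (rule AE_I2)
      fix x assume "x \<in> space M"
      from lF[OF this, of 0] Fu[OF this, of 0] show "norm (F x) \<le> norm (\<bar>l 0 x\<bar> + \<bar>u 0 x\<bar>)" by auto
    qed
  qed
qed

lemma weighted_measure_prob_space:
  assumes \<Omega>: "\<Omega> \<in> sets lebesgue" and w: "\<And>x. x \<in> \<Omega> \<Longrightarrow> 0 \<le> w x"
    and int: "integrable (lebesgue_on \<Omega>) w" and one: "(LINT x|lebesgue_on \<Omega>. w x) = 1"
  shows "prob_space (weighted_measure \<Omega> w)"
proof
  have nonneg: "AE x in lebesgue_on \<Omega>. 0 \<le> w x"
    using w by (intro AE_I2) simp
  have "emeasure (weighted_measure \<Omega> w) (space (weighted_measure \<Omega> w)) = (\<integral>\<^sup>+ x. ennreal (w x) \<partial>lebesgue_on \<Omega>)"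
    unfolding weighted_measure_def using int
    by (subst emeasure_density) (auto intro!: nn_integral_cong)
  also have "\<dots> = 1"
    using nn_integral_eq_integral[OF int nonneg] one by simp
  finally show "emeasure (weighted_measure \<Omega> w) (space (weighted_measure \<Omega> w)) = 1" .
qed

lemma integral_distr_weighted_measure:
  fixes h :: "real \<Rightarrow> real"
  assumes w: "\<And>x. x \<in> \<Omega> \<Longrightarrow> 0 \<le> w x" and wm: "w \<in> borel_measurable (lebesgue_on \<Omega>)"
    and G: "G \<in> borel_measurable (lebesgue_on \<Omega>)"
    and h: "integrable (distr (weighted_measure \<Omega> w) borel G) h"
  shows "integrable (lebesgue_on \<Omega>) (\<lambda>x. h (G x) * w x)"
    and "(LINT x|distr (weighted_measure \<Omega> w) borel G. h x) = (LINT x|lebesgue_on \<Omega>. h (G x) * w x)"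
proof -
  note [measurable] = wm G
  have hm [measurable]: "h \<in> borel_measurable borel"
    using borel_measurable_integrable[OF h] by simp
  have Gm: "G \<in> borel_measurable (weighted_measure \<Omega> w)"
    using G by (simp add: weighted_measure_def)
  have nonneg: "AE x in lebesgue_on \<Omega>. 0 \<le> w x"
    using w by (intro AE_I2) simp
  have hG: "(\<lambda>x. h (G x)) \<in> borel_measurable (lebesgue_on \<Omega>)" by measurable
  have "integrable (weighted_measure \<Omega> w) (\<lambda>x. h (G x))"
    using h by (simp add: integrable_distr_eq[OF Gm hm])
  then show "integrable (lebesgue_on \<Omega>) (\<lambda>x. h (G x) * w x)"
    unfolding weighted_measure_def integrable_density[OF hG wm nonneg] by (simp add: mult.commute)
  show "(LINT x|distr (weighted_measure \<Omega> w) borel G. h x) = (LINT x|lebesgue_on \<Omega>. h (G x) * w x)"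
    unfolding integral_distr[OF Gm hm] unfolding weighted_measure_def integral_density[OF hG wm nonneg]
    by (simp add: mult.commute)
qed

section \<open>Convergence of the truncated functional calculus\<close>

theorem theorem20:
  fixes \<Omega> :: "(real ^ 'd::finite) set"
    and w :: "real ^ 'd \<Rightarrow> real"
    and \<phi> :: "nat \<Rightarrow> ('d, complex) mpolynomial"
    and g :: "('d, real) mpolynomial"
    and f :: "real \<Rightarrow> real"
    and a b :: real
    and m :: nat
  assumes "\<Omega> \<in> sets lebesgue"
    and "\<And>x. x \<in> \<Omega> \<Longrightarrow> 0 \<le> w x"
    and "integrable (lebesgue_on \<Omega>) w"
    and "(LINT x|lebesgue_on \<Omega>. w x) = 1"
    and "l2_orthonormal (weighted_measure \<Omega> w) (\<lambda>i. eval_mpoly (\<phi> i))"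
    and "\<phi> 0 = 1"
    and "mono (\<lambda>i. total_degree (\<phi> i))"
    and "spans_by_degree \<phi>"
    and "l2_dense (weighted_measure \<Omega> w) (fun_span (\<lambda>i. eval_mpoly (\<phi> i)))"
    and "self_adjoint ell2_measure
           (matrix_op (mult_entry (weighted_measure \<Omega> w) (\<lambda>i. eval_mpoly (\<phi> i)) (eval_mpoly g)))"
    and "identified_by (weighted_measure \<Omega> w) (\<lambda>i. eval_mpoly (\<phi> i))
           (matrix_op (mult_entry (weighted_measure \<Omega> w) (\<lambda>i. eval_mpoly (\<phi> i)) (eval_mpoly g)))
           (mult_op (weighted_measure \<Omega> w) (eval_mpoly g))"
    and "0 < a" and "0 < b"
    and "\<And>x. \<bar>f x\<bar> \<le> a + b * \<bar>x\<bar> ^ m"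
    and "rs_integrable_op (weighted_measure \<Omega> w)
           (mult_op (weighted_measure \<Omega> w) (eval_mpoly g)) f"
  shows "integrable (lebesgue_on \<Omega>) (\<lambda>x. f (eval_mpoly g x) * w x) \<and>
    (\<lambda>n. hermitian_fun f
           (trunc_matrix
              (mult_entry (weighted_measure \<Omega> w) (\<lambda>i. eval_mpoly (\<phi> i)) (eval_mpoly g)) n)
           $$ (0, 0))
      \<longlonglongrightarrow> complex_of_real (LINT x|lebesgue_on \<Omega>. f (eval_mpoly g x) * w x)"
proof -
  note \<Omega> = assms(1) and w = assms(2) and w_int = assms(3) and w_one = assms(4)
  note orthonormal = assms(5) and sa = assms(10) and ab = assms(12,13) and f_bound = assms(14) and rs = assms(15)
  define M where "M = weighted_measure \<Omega> w"
  define \<Phi> where "\<Phi> i = eval_mpoly (\<phi> i)" for i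
  define G where "G = eval_mpoly g"
  define \<mu> where "\<mu> = distr M borel G"
  have G_leb: "G \<in> borel_measurable (lebesgue_on \<Omega>)"
    unfolding G_def
    by (intro measurable_restrict_space1 measurable_completion)
      (simp add: borel_measurable_continuous_onI continuous_on_eval_mpoly)
  then have G_M: "G \<in> borel_measurable M"
    by (simp add: M_def weighted_measure_def)
  have w_meas: "w \<in> borel_measurable (lebesgue_on \<Omega>)"
    using w_int by (rule borel_measurable_integrable)
  interpret multiplication_matrix M \<Phi> G
  proof (intro multiplication_matrix.intro multiplication_matrix_axioms.intro)
    show "prob_space M"
      unfolding M_def by (rule weighted_measure_prob_space[OF \<Omega> w w_int w_one])
    show "G \<in> borel_measurable M" by (rule G_M)
    show "l2_orthonormal M \<Phi>"
      using orthonormal by (simp only: M_def \<Phi>_def[abs_def])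
    show "\<Phi> 0 = (\<lambda>_. 1)"
      using assms(6) by (simp add: \<Phi>_def fun_eq_iff eval_mpoly_one)
    show "(\<lambda>x. complex_of_real (G x) * \<Phi> i x) \<in> fun_span \<Phi>" for i
    proof -
      obtain r where "\<forall>x. complex_of_real (eval_mpoly g x) * eval_mpoly (\<phi> i) x = eval_mpoly r x"
        using eval_mpoly_real_times by blast
      then have "(\<lambda>x. complex_of_real (G x) * \<Phi> i x) = eval_mpoly r"
        by (simp add: G_def \<Phi>_def fun_eq_iff)
      then show ?thesis
        using spans_by_degree_fun_span[OF assms(8), of r] by (simp add: \<Phi>_def[abs_def])
    qed
  qed
  have sa: "self_adjoint ell2_measure (matrix_op entry)"
    using sa by (simp only: M_def G_def \<Phi>_def[abs_def])
  have "\<forall>n. \<exists>u d. diagonalizes n u d \<and> (\<forall>f. hermitian_fun f (trunc_matrix entry n) $$ (0, 0) =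
     complex_of_real (\<Sum>k\<le>n. (cmod (u 0 k))\<^sup>2 * f (d k)))"
    using trunc_matrix_functional_calculus by (rule allI)
  then obtain u where "\<forall>n. \<exists>d. diagonalizes n (u n) d \<and> (\<forall>f. hermitian_fun f (trunc_matrix entry n) $$ (0, 0) =
     complex_of_real (\<Sum>k\<le>n. (cmod (u n 0 k))\<^sup>2 * f (d k)))"
    by (rule choice[THEN exE])
  then obtain d where ud: "\<forall>n. diagonalizes n (u n) (d n) \<and> (\<forall>f. hermitian_fun f (trunc_matrix entry n) $$ (0, 0) =
     complex_of_real (\<Sum>k\<le>n. (cmod (u n 0 k))\<^sup>2 * f (d n k)))"
    by (rule choice[THEN exE])
  then have diag: "\<And>n. diagonalizes n (u n) (d n)" by blast
  interpret Q: poisson_quadrature \<mu> "\<lambda>n k. (cmod (u n 0 k))\<^sup>2" d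
    unfolding \<mu>_def by (rule diagonalizes_poisson_quadrature[OF sa diag])
  have moment: "Q.converges (\<lambda>x. x ^ k)" for k
  proof -
    obtain N where "\<forall>n\<ge>N. \<forall>u d. diagonalizes n u d \<longrightarrow> (\<Sum>l\<le>n. (cmod (u 0 l))\<^sup>2 * d l ^ k) = (LINT x|M. G x ^ k)"
      using truncated_moments_exact by blast
    then have "\<forall>n\<ge>N. Q.quad n (\<lambda>x. x ^ k) = (LINT x|M. G x ^ k)"
      using diag by (simp add: Q.quad_def)
    then have "(\<lambda>n. Q.quad n (\<lambda>x. x ^ k)) \<longlonglongrightarrow> (LINT x|M. G x ^ k)"
      by (intro tendsto_eventually) (auto simp: eventually_sequentially)
    moreover have "(LINT x|\<mu>. x ^ k) = (LINT x|M. G x ^ k)"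
      unfolding \<mu>_def by (rule integral_distr[OF G_M]) simp
    moreover have "integrable \<mu> (\<lambda>x. x ^ k)"
      unfolding \<mu>_def using integrable_power_g by (subst integrable_distr_eq[OF G_M]) simp_all
    ultimately show ?thesis by (simp add: Q.converges_def)
  qed
  have rs_mu: "rs_integrable f (cdf \<mu>) (-R) R"
    if R: "R > 0" "measure \<mu> {-R} = 0" "measure \<mu> {R} = 0" for R
  proof -
    have no_eig: "\<not> op_eigenvalue M (mult_op M G) c" if "measure \<mu> {c} = 0" for c
    proof
      assume "op_eigenvalue M (mult_op M G) c"
      then have "\<not> (AE x in M. G x \<noteq> c)" by (rule op_eigenvalue_mult_op_atom[OF G_M])
      moreover have "AE x in \<mu>. x \<noteq> c"
        using that by (subst AE_iff_measurable[of "{c}"]) (auto simp: Q.emeasure_eq_measure)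
      then have "AE x in M. G x \<noteq> c"
        unfolding \<mu>_def by (subst (asm) AE_distr_iff[OF G_M]) simp_all
      ultimately show False by blast
    qed
    \<comment> \<open>The vector 1 has spectral distribution \<open>cdf \<mu>\<close>.\<close>
    have one_L2: "(\<lambda>_. 1) \<in> L2 M" using phi_L2[of 0] by (simp only: phi_0)
    have "spectral_distr M (spectral_cut G) (\<lambda>_. 1) = cdf \<mu>"
      unfolding spectral_distr_cut[OF G_M one_L2] by (simp add: spectral_measure_def \<mu>_def density_1)
    moreover have "rs_integrable f (spectral_distr M (spectral_cut G) (\<lambda>_. 1)) (-R) R"
      using rs[folded M_def G_def] spectral_family_mult_op[OF G_M] no_eig[OF R(2)] no_eig[OF R(3)] one_L2 R(1)
      unfolding rs_integrable_op_def by simp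
    ultimately show ?thesis by simp
  qed
  note sandwich = Q.polynomially_bounded_sandwich[OF _ ab f_bound moment rs_mu]
  have G_int: "integrable (lebesgue_on \<Omega>) (\<lambda>x. h (G x) * w x)"
    and G_integral: "(LINT x|\<mu>. h x) = (LINT x|lebesgue_on \<Omega>. h (G x) * w x)" if "Q.converges h" for h
  proof -
    have "integrable \<mu> h" using that by (simp only: Q.converges_def)
    then have h: "integrable (distr (weighted_measure \<Omega> w) borel G) h" by (simp only: \<mu>_def M_def)
    show "integrable (lebesgue_on \<Omega>) (\<lambda>x. h (G x) * w x)"
      "(LINT x|\<mu>. h x) = (LINT x|lebesgue_on \<Omega>. h (G x) * w x)"
      using integral_distr_weighted_measure[OF w w_meas G_leb h] by (simp_all only: \<mu>_def M_def)
  qed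
  have le: "l (G x) * w x \<le> u (G x) * w x" if "\<forall>x. l x \<le> u x" "x \<in> space (lebesgue_on \<Omega>)" for l u x
    using that w by (intro mult_right_mono) auto
  have int: "integrable (lebesgue_on \<Omega>) (\<lambda>x. f (G x) * w x)"
  proof (rule complete_measure.integrable_sandwich[OF complete_measure_lebesgue_on[OF \<Omega>]])
    fix \<epsilon> :: real assume "\<epsilon> > 0"
    then obtain l u where lu: "Q.converges l" "Q.converges u" "\<forall>x. l x \<le> f x \<and> f x \<le> u x"
      "(LINT x|\<mu>. u x) - (LINT x|\<mu>. l x) < \<epsilon>"
      using sandwich by blast
    then show "\<exists>l u. integrable (lebesgue_on \<Omega>) l \<and> integrable (lebesgue_on \<Omega>) u \<and>
      (\<forall>x\<in>space (lebesgue_on \<Omega>). l x \<le> f (G x) * w x \<and> f (G x) * w x \<le> u x) \<and>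
      (LINT x|lebesgue_on \<Omega>. u x) - (LINT x|lebesgue_on \<Omega>. l x) < \<epsilon>"
      using le[of l f] le[of f u]
      by (intro exI[of _ "\<lambda>x. l (G x) * w x"] exI[of _ "\<lambda>x. u (G x) * w x"]) (simp add: G_int G_integral)
  qed
  have "(\<lambda>n. Q.quad n f) \<longlonglongrightarrow> (LINT x|lebesgue_on \<Omega>. f (G x) * w x)"
  proof (rule Q.quad_sandwich)
    fix \<epsilon> :: real assume "\<epsilon> > 0"
    then obtain l u where lu: "Q.converges l" "Q.converges u" "\<forall>x. l x \<le> f x \<and> f x \<le> u x"
      "(LINT x|\<mu>. u x) - (LINT x|\<mu>. l x) < \<epsilon>"
      using sandwich by blast
    moreover have "(LINT x|\<mu>. l x) \<le> (LINT x|lebesgue_on \<Omega>. f (G x) * w x)"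
      unfolding G_integral[OF lu(1)] using lu by (intro integral_mono G_int int le) auto
    moreover have "(LINT x|lebesgue_on \<Omega>. f (G x) * w x) \<le> (LINT x|\<mu>. u x)"
      unfolding G_integral[OF lu(2)] using lu by (intro integral_mono G_int int le) auto
    ultimately show "\<exists>l u. Q.converges l \<and> Q.converges u \<and> (\<forall>x. l x \<le> f x \<and> f x \<le> u x) \<and>
      (LINT x|\<mu>. l x) \<le> (LINT x|lebesgue_on \<Omega>. f (G x) * w x) \<and>
      (LINT x|lebesgue_on \<Omega>. f (G x) * w x) \<le> (LINT x|\<mu>. u x) \<and> (LINT x|\<mu>. u x) - (LINT x|\<mu>. l x) < \<epsilon>"
      by blast
  qed
  then have "(\<lambda>n. hermitian_fun f (trunc_matrix entry n) $$ (0, 0)) \<longlonglongrightarrow>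
      complex_of_real (LINT x|lebesgue_on \<Omega>. f (G x) * w x)"
    using ud tendsto_of_real[where 'a=complex] by (fastforce simp: Q.quad_def)
  with int show ?thesis
    by (simp only: M_def G_def \<Phi>_def[abs_def])
qed

end
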